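(* There is a constant $c$ such that, for every integer $d\ge 3$, $$n^{d^2+d-2} \lesssim S(n,d) \lesssim n^{d^2+2d-4+c/\log\log n} + n^{d^2+d}\log n$$ as $n\to\infty$.
   Context: $[n]=\{1,\dots,n\}$. $S(n,d)$ is the number of $(d+2)$-tuples (ordered, with distinct entries) of points in $[n]^d$ that lie on a common $(d-1)$-dimensional sphere in $\mathbb{R}^d$ (i.e. a set $\{x\in\mathbb{R}^d:\|x-x_0\|_2=\rho\}$ with $x_0\in\mathbb{R}^d$, $\rho>0$; hyperplanes are not counted as spheres here). The notation $X\lesssim Y$ means $X\le CY$ for all sufficiently large $n$, where $C>0$ may depend on $d$ but not on $n$. *)

theory Defs
  imports "HOL-Analysis.Analysis"
begin

text \<open>Since the dimension \<open>d\<close> is quantified inside the statement, \<open>\<real>\<^sup>d\<close> is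
  represented by the real functions on the coordinates \<open>{..<d}\<close>, normalised to be
  \<open>undefined\<close> elsewhere so that equality of functions is equality of points.\<close>

definition Rspace :: "nat \<Rightarrow> (nat \<Rightarrow> real) set" where
  "Rspace d = ({..<d} \<rightarrow>\<^sub>E UNIV)"

definition grid :: "nat \<Rightarrow> nat \<Rightarrow> (nat \<Rightarrow> real) set" where
  "grid d n = ({..<d} \<rightarrow>\<^sub>E real ` {1..n})"

definition euclid_sphere :: "nat \<Rightarrow> (nat \<Rightarrow> real) \<Rightarrow> real \<Rightarrow> (nat \<Rightarrow> real) set" where
  "euclid_sphere d x0 \<rho> = {x \<in> Rspace d. L2_set (\<lambda>i. x i - x0 i) {..<d} = \<rho>}"

text \<open>Tuples are lists; being \<open>distinct\<close>, they are ordered tuples with pairwise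
  different entries. The set counted is finite because \<open>grid d n\<close> is.\<close>

definition cospherical_count :: "nat \<Rightarrow> nat \<Rightarrow> nat" where
  "cospherical_count n d =
     card {ps. length ps = d + 2 \<and> distinct ps \<and> set ps \<subseteq> grid d n \<and>
               (\<exists>x0 \<in> Rspace d. \<exists>\<rho>>0. set ps \<subseteq> euclid_sphere d x0 \<rho>)}"

definition lesssim :: "(nat \<Rightarrow> real) \<Rightarrow> (nat \<Rightarrow> real) \<Rightarrow> bool" where
  "lesssim X Y \<longleftrightarrow> (\<exists>C>0. \<forall>\<^sub>F n in sequentially. X n \<le> C * Y n)"

end

(*
  Upper bound. A pigeonhole over dyadic cells shows that the sections A of the grid by spheres satisfy
  sum |A|^(d+2) <= C n^(d(d+1)), which is stronger than the claim. For a point p of A go through the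
  dyadic cells around p from small to large and pick a new point of A each time the points of A in the
  cell leave the flat spanned by p and the points picked so far. The picked points determine A, and the
  sizes of the cells bound the number of ways to pick them. On the other hand, just below each of these
  scales the points of A in the cell lie on a sphere of dimension k - 1 inside a k-dimensional flat,
  and such a sphere meets only O(q^(k-1)) of the smaller cells when the side is divided by q. Hence
  the number of points p of A with prescribed scales is small exactly when the number of ways to pick
  is large.

  Lower bound. For a centre c and a vector z with |z|^2 = r, reflect c + z in coordinate hyperplanes
  through c. If z is close to the diagonal, d + 1 such points are affinely independent, so that c can
  be recovered, and the power mean inequality over the O(n^2) values of r gives the count.
*)

theory Submission
  imports Defs "HOL-Real_Asymp.Real_Asymp"
begin

section \<open>Flats\<close>

text \<open>A sphere is pinned down by d + 1 points in general position, hence the target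
  n^(d(d+1)). Two things spoil that count: every tuple has one point more, and tuples may lie on
  spheres of lower dimension, which determine no centre. Hence sections are summed as point sets,
  not as spheres, and each is encoded by p and only t <= d picked points. Write 2^l for the side,
  comparable to n, a for the largest level and b for the sum of the other levels. The pairs (A, p)
  number O(2^(l d (t + 1) - d (a + b))), whereas one A has O(2^b) such points p. Of the d + 2
  factors, t + 1 are bounded by O(2^b), d - t trivially by 2^(l d), and the last one counts pairs.
  Since b <= (t - 1) a and t <= d, a factor 2^(-a) is left over. It pays for summing over all lists
  of levels, so no logarithm is lost and \<open>c = 0\<close> suffices. In the lower bound h is
  comparable to n. There are h^d centres, and h^d vectors share O(h^2) values of r, so on average r
  has h^(d - 2) vectors; choosing one for each of d + 2 points gives h^(d + 2 + (d - 2)(d + 2)) =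
  h^(d^2 + d - 2) tuples.\<close>

fun flat :: "nat \<Rightarrow> (nat \<Rightarrow> real) \<Rightarrow> (nat \<Rightarrow> real) list \<Rightarrow> (nat \<Rightarrow> real) set" where
  "flat d p [] = {x. \<forall>j<d. x j = p j}"
| "flat d p (y # ys) = {x. \<exists>c. (\<lambda>j. x j - c * (y j - p j)) \<in> flat d p ys}"

fun affinely_free :: "nat \<Rightarrow> (nat \<Rightarrow> real) \<Rightarrow> (nat \<Rightarrow> real) list \<Rightarrow> bool" where
  "affinely_free d p [] = True"
| "affinely_free d p (y # ys) = (affinely_free d p ys \<and> y \<notin> flat d p ys)"

lemma flat_Cons_mono: "x \<in> flat d p ys \<Longrightarrow> x \<in> flat d p (y # ys)"
  by (auto intro: exI[of _ 0])

lemma base_in_flat: "p \<in> flat d p ys"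
  by (induction ys) (auto intro: exI[of _ 0])

text \<open>Adding a vertex to the flat adds to \<open>I\<close> the coordinate in which the new direction differs
  most from what \<open>\<gamma>\<close> predicts; this choice keeps the coefficients bounded.\<close>

lemma flat_coordinates:
  assumes "affinely_free d p ys"
  shows "\<exists>I \<gamma>. I \<subseteq> {..<d} \<and> card I = length ys \<and>
    (\<forall>j i. \<bar>\<gamma> j i :: real\<bar> \<le> 2 ^ length ys) \<and>
    (\<forall>j\<in>I. \<forall>i\<in>I. \<gamma> j i = (if i = j then 1 else 0)) \<and>
    (\<forall>x. x \<in> flat d p ys \<longleftrightarrow> (\<forall>j<d. x j - p j = (\<Sum>i\<in>I. \<gamma> j i * (x i - p i))))"
  using assms
proof (induction ys)
  case Nil
  show ?case by (intro exI[of _ "{}"] exI[of _ "\<lambda>_ _. 0"]) auto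
next
  case (Cons y ys)
  have free: "affinely_free d p ys" using Cons.prems by simp
  from Cons.IH[OF this]
  obtain I \<gamma> where I: "I \<subseteq> {..<d}" "card I = length ys"
    and \<gamma>: "\<And>j i. \<bar>\<gamma> j i :: real\<bar> \<le> 2 ^ length ys"
    and del: "\<And>j i. j \<in> I \<Longrightarrow> i \<in> I \<Longrightarrow> \<gamma> j i = (if i = j then 1 else 0)"
    and fl: "\<And>x. x \<in> flat d p ys \<longleftrightarrow> (\<forall>j<d. x j - p j = (\<Sum>i\<in>I. \<gamma> j i * (x i - p i)))"
    by blast
  have finI: "finite I" using I(1) finite_subset by blast
  \<comment> \<open>\<open>R x j\<close> is the error made when coordinate \<open>j\<close> is
    predicted from those in \<open>I\<close>; it is linear in \<open>x - p\<close>, and on the flat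
    it vanishes for all \<open>j < d\<close>, and only there.\<close>
  define R where "R x j = x j - p j - (\<Sum>i\<in>I. \<gamma> j i * (x i - p i))" for x :: "nat \<Rightarrow> real" and j
  have RI: "R x j = 0" if "j \<in> I" for x j
  proof -
    have "(\<Sum>i\<in>I. \<gamma> j i * (x i - p i)) = (\<Sum>i\<in>I. if i = j then x j - p j else 0)"
      by (rule sum.cong) (use that del in auto)
    then show ?thesis unfolding R_def using that finI by simp
  qed
  have Rlin: "R (\<lambda>j. x j - c * (y j - p j)) j = R x j - c * R y j" for x c j
    unfolding R_def by (simp add: algebra_simps sum_subtractf sum_distrib_left sum.distrib)
  have flR: "x \<in> flat d p ys \<longleftrightarrow> (\<forall>j<d. R x j = 0)" for x
    unfolding fl R_def by simp
  from Cons.prems obtain j0 where j0: "j0 < d" "R y j0 \<noteq> 0" using flR by auto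
  have "finite ((\<lambda>j. \<bar>R y j\<bar>) ` {..<d})" "(\<lambda>j. \<bar>R y j\<bar>) ` {..<d} \<noteq> {}"
    using j0 by auto
  then have "Max ((\<lambda>j. \<bar>R y j\<bar>) ` {..<d}) \<in> (\<lambda>j. \<bar>R y j\<bar>) ` {..<d}" by (rule Max_in)
  then obtain m where m: "m < d" "\<bar>R y m\<bar> = Max ((\<lambda>j. \<bar>R y j\<bar>) ` {..<d})" by auto
  have mmax: "\<bar>R y j\<bar> \<le> \<bar>R y m\<bar>" if "j < d" for j
    unfolding m(2) using that by (intro Max_ge) auto
  have m0: "R y m \<noteq> 0" using mmax[OF j0(1)] j0(2) by auto
  have mI: "m \<notin> I" using RI m0 by blast
  \<comment> \<open>The value 0 from \<open>d\<close> on makes the bound 1 hold for every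
    index.\<close>
  define \<rho> where "\<rho> j = (if j < d then R y j / R y m else 0)" for j
  have \<rho>1: "\<bar>\<rho> j\<bar> \<le> 1" for j using mmax m0 by (auto simp: \<rho>_def field_simps)
  \<comment> \<open>The old prediction, corrected by \<open>\<rho> j\<close> times the error at
    \<open>m\<close>; expanding that error gives these coefficients. The bound doubles with each
    vertex, whence \<open>2 ^ length ys\<close>.\<close>
  define \<gamma>' where "\<gamma>' j i = (if i = m then \<rho> j else \<gamma> j i - \<rho> j * \<gamma> m i)" for j i
  have split: "(\<Sum>i\<in>insert m I. \<gamma>' j i * (x i - p i))
      = (\<Sum>i\<in>I. \<gamma> j i * (x i - p i)) + \<rho> j * R x m" for x j
  proof -
    have "(\<Sum>i\<in>I. \<gamma>' j i * (x i - p i))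
        = (\<Sum>i\<in>I. \<gamma> j i * (x i - p i) - \<rho> j * (\<gamma> m i * (x i - p i)))"
      by (rule sum.cong) (use mI in \<open>auto simp: \<gamma>'_def algebra_simps\<close>)
    also have "\<dots> = (\<Sum>i\<in>I. \<gamma> j i * (x i - p i)) - \<rho> j * (\<Sum>i\<in>I. \<gamma> m i * (x i - p i))"
      by (simp only: sum_subtractf sum_distrib_left)
    finally have "(\<Sum>i\<in>insert m I. \<gamma>' j i * (x i - p i)) = \<rho> j * (x m - p m) + \<dots>"
      using finI mI by (simp add: \<gamma>'_def)
    then show ?thesis by (simp add: R_def right_diff_distrib)
  qed
  have iff: "x \<in> flat d p (y # ys) \<longleftrightarrow>
      (\<forall>j<d. x j - p j = (\<Sum>i\<in>insert m I. \<gamma>' j i * (x i - p i)))" for x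
  proof -
    have "x \<in> flat d p (y # ys) \<longleftrightarrow> (\<exists>c. \<forall>j<d. R x j = c * R y j)"
      by (simp add: flR Rlin)
    also have "\<dots> \<longleftrightarrow> (\<forall>j<d. R x j = \<rho> j * R x m)"
    proof
      assume "\<exists>c. \<forall>j<d. R x j = c * R y j"
      then obtain c where "\<And>j. j < d \<Longrightarrow> R x j = c * R y j" by auto
      then show "\<forall>j<d. R x j = \<rho> j * R x m" using m m0 by (auto simp: \<rho>_def)
    next
      assume "\<forall>j<d. R x j = \<rho> j * R x m"
      then show "\<exists>c. \<forall>j<d. R x j = c * R y j"
        by (intro exI[of _ "R x m / R y m"]) (auto simp: \<rho>_def)
    qed
    also have "\<dots> \<longleftrightarrow> (\<forall>j<d. x j - p j = (\<Sum>i\<in>insert m I. \<gamma>' j i * (x i - p i)))"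
      unfolding split by (simp add: R_def[of _ j for j] algebra_simps)
    finally show ?thesis .
  qed
  have bd: "\<bar>\<gamma>' j i\<bar> \<le> 2 ^ length (y # ys)" for j i
  proof (cases "i = m")
    case True
    have "(1::real) \<le> 2 ^ length (y # ys)" by (rule one_le_power) simp
    then show ?thesis using True \<rho>1[of j] by (simp add: \<gamma>'_def)
  next
    case False
    have "\<bar>\<rho> j * \<gamma> m i\<bar> \<le> 1 * 2 ^ length ys"
      unfolding abs_mult using \<rho>1 \<gamma> by (intro mult_mono) auto
    then have "\<bar>\<gamma> j i - \<rho> j * \<gamma> m i\<bar> \<le> 2 ^ length ys + 2 ^ length ys"
      using \<gamma>[of j i] by linarith
    then show ?thesis using False by (simp add: \<gamma>'_def)
  qed
  have del': "\<gamma>' j i = (if i = j then 1 else 0)" if "j \<in> insert m I" "i \<in> insert m I" for j i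
  proof (cases "j = m")
    case True
    have "\<rho> m = 1" using m m0 by (simp add: \<rho>_def)
    then show ?thesis using True by (simp add: \<gamma>'_def)
  next
    case False
    then have "j \<in> I" using that by auto
    then have "\<rho> j = 0" using RI by (simp add: \<rho>_def)
    then show ?thesis using that False del \<open>j \<in> I\<close> by (auto simp: \<gamma>'_def)
  qed
  show ?case
    apply (intro exI[of _ "insert m I"] exI[of _ \<gamma>'])
    using I m mI finI bd del' iff by auto
qed

lemma length_le_of_affinely_free:
  assumes "affinely_free d p ys"
  shows "length ys \<le> d"
proof -
  obtain I :: "nat set" where "I \<subseteq> {..<d}" "card I = length ys"
    using flat_coordinates[OF assms] by blast
  then show ?thesis using card_mono[of "{..<d}" I] by simp
qed

section \<open>Dyadic cells met by a sphere\<close>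

definition cell :: "nat \<Rightarrow> nat \<Rightarrow> nat \<Rightarrow> (nat \<Rightarrow> real) \<Rightarrow> nat \<Rightarrow> int" where
  "cell d l h x = (\<lambda>j\<in>{..<d}. \<lfloor>x j * 2 ^ h / 2 ^ l\<rfloor>)"

lemma card_image_le_of_factor:
  assumes "finite F" "\<Phi> ` X \<subseteq> F"
    and "\<And>x y. x \<in> X \<Longrightarrow> y \<in> X \<Longrightarrow> \<Phi> x = \<Phi> y \<Longrightarrow> f x = f y"
  shows "card (f ` X) \<le> card F"
proof -
  have "f x = f (SOME y. y \<in> X \<and> \<Phi> y = \<Phi> x)" if "x \<in> X" for x
  proof (rule someI2[of "\<lambda>y. y \<in> X \<and> \<Phi> y = \<Phi> x" x])
    show "x \<in> X \<and> \<Phi> x = \<Phi> x" using that by simp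
    fix y assume "y \<in> X \<and> \<Phi> y = \<Phi> x"
    then show "f x = f y" using assms(3)[OF that, of y] by simp
  qed
  then have "f ` X = (\<lambda>u. f (SOME y. y \<in> X \<and> \<Phi> y = u)) ` \<Phi> ` X"
    unfolding image_image by (rule image_cong[OF refl])
  also have "card \<dots> \<le> card (\<Phi> ` X)"
    using assms(1,2) by (intro card_image_le) (rule finite_subset)
  also have "\<dots> \<le> card F" using assms(1,2) by (rule card_mono)
  finally show ?thesis .
qed

lemma card_image_le_fibres:
  assumes "finite (g ` X)"
    and "\<And>x. x \<in> X \<Longrightarrow> card (f ` {y \<in> X. g y = g x}) \<le> B"
  shows "card (f ` X) \<le> card (g ` X) * B"
proof -
  have "f ` X = (\<Union>u\<in>g ` X. f ` {y \<in> X. g y = u})" by auto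
  then have "card (f ` X) \<le> (\<Sum>u\<in>g ` X. card (f ` {y \<in> X. g y = u}))"
    using card_UN_le[OF assms(1)] by metis
  also have "\<dots> \<le> (\<Sum>u\<in>g ` X. B)" by (rule sum_mono) (use assms(2) in auto)
  finally show ?thesis by simp
qed

text \<open>Classify the points by the sign pattern of their supporting functional \<open>w\<close>. A functional with
  sign pattern \<open>\<epsilon>\<close> is nonnegative in every direction of the orthant of \<open>\<epsilon>\<close>, so that
  each line of cells in direction \<open>\<epsilon>\<close> contains at most one cell of that class.\<close>

lemma card_cells_convex_position:
  fixes s :: real and X :: "(nat \<Rightarrow> real) set" and I :: "nat set" and q :: nat
  defines "c \<equiv> \<lambda>x. \<lambda>i\<in>I. \<lfloor>x i / s\<rfloor>"
  assumes I: "finite I" "I \<noteq> {}" and s: "s > 0"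
    and supp: "\<And>x. x \<in> X \<Longrightarrow> \<exists>w. \<forall>y\<in>X. c y \<noteq> c x \<longrightarrow> (\<Sum>i\<in>I. w i * (y i - x i)) < 0"
    and b: "\<And>x i. x \<in> X \<Longrightarrow> i \<in> I \<Longrightarrow> b i \<le> c x i \<and> c x i < b i + int q"
  shows "card (c ` X) \<le> 2 ^ card I * (4 * q) ^ (card I - 1)"
proof -
  obtain w where w: "\<And>x y. x \<in> X \<Longrightarrow> y \<in> X \<Longrightarrow> c y \<noteq> c x \<Longrightarrow> (\<Sum>i\<in>I. w x i * (y i - x i)) < 0"
    using supp by metis
  obtain k where k: "k \<in> I" using I by auto
  define \<epsilon> where "\<epsilon> x = (\<lambda>i\<in>I. if w x i \<ge> 0 then 1 else - 1 :: int)" for x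
  \<comment> \<open>The position of the cell modulo the direction \<open>\<epsilon> x\<close>: as
    its entries are 1 or -1, cells with equal sign pattern and equal \<open>v\<close> lie on one
    line in that direction.\<close>
  define v where "v x = (\<lambda>i\<in>I - {k}. \<epsilon> x i * (c x i - b i) - \<epsilon> x k * (c x k - b k))" for x
  let ?F = "(I \<rightarrow>\<^sub>E {1, -1 :: int}) \<times> (I - {k} \<rightarrow>\<^sub>E {- 2 * int q..<2 * int q})"
  \<comment> \<open>Cell indices that are strictly ahead force coordinates that are ahead, wherever
    the points lie in their cells; then no term of the functional is negative.\<close>
  have no: False if "x \<in> X" "y \<in> X" "\<forall>i\<in>I. \<epsilon> x i * (c y i - c x i) \<ge> 1" for x y
  proof -
    have "w x i * (y i - x i) \<ge> 0" if i: "i \<in> I" for i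
    proof (cases "w x i \<ge> 0")
      case True
      then have "\<lfloor>y i / s\<rfloor> > \<lfloor>x i / s\<rfloor>" using \<open>\<forall>i\<in>I. _\<close> i by (auto simp: \<epsilon>_def c_def)
      then have "y i / s > x i / s" by linarith
      then have "y i > x i" using s by (simp add: divide_strict_right_mono field_simps)
      then show ?thesis using True by simp
    next
      case False
      then have "\<lfloor>y i / s\<rfloor> < \<lfloor>x i / s\<rfloor>" using \<open>\<forall>i\<in>I. _\<close> i by (force simp: \<epsilon>_def c_def)
      then have "y i / s < x i / s" by linarith
      then have "y i < x i" using s by (simp add: field_simps)
      then show ?thesis using False by (simp add: mult_nonpos_nonpos)
    qed
    then have "(\<Sum>i\<in>I. w x i * (y i - x i)) \<ge> 0" by (rule sum_nonneg)
    moreover have "c y \<noteq> c x" using that(3) k by auto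
    ultimately show False using w[OF that(1,2)] by linarith
  qed
  have "card (c ` X) \<le> card ?F"
  proof (rule card_image_le_of_factor[of _ "\<lambda>x. (\<epsilon> x, v x)"])
    show "finite ?F" using I by (auto intro!: finite_PiE)
    show "(\<lambda>x. (\<epsilon> x, v x)) ` X \<subseteq> ?F"
    proof (intro image_subsetI SigmaI)
      fix x assume x: "x \<in> X"
      show "\<epsilon> x \<in> I \<rightarrow>\<^sub>E {1, -1}" by (auto simp: \<epsilon>_def)
      show "v x \<in> I - {k} \<rightarrow>\<^sub>E {- 2 * int q..<2 * int q}"
      proof (intro PiE_I)
        fix i assume i: "i \<in> I - {k}"
        have bd: "\<bar>\<epsilon> x j * (c x j - b j)\<bar> < int q" if "j \<in> I" for j
          using b[OF x that] that by (auto simp: \<epsilon>_def)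
        have "v x i = \<epsilon> x i * (c x i - b i) - \<epsilon> x k * (c x k - b k)"
          using i by (simp add: v_def)
        moreover have "\<bar>\<epsilon> x i * (c x i - b i)\<bar> < int q" "\<bar>\<epsilon> x k * (c x k - b k)\<bar> < int q"
          using bd i k by auto
        ultimately show "v x i \<in> {- 2 * int q..<2 * int q}"
          unfolding atLeastLessThan_iff by linarith
      qed (simp only: v_def restrict_apply if_False)
    qed
    fix x y assume xy: "x \<in> X" "y \<in> X" and eq: "(\<epsilon> x, v x) = (\<epsilon> y, v y)"
    define t where "t = \<epsilon> x k * (c y k - c x k)"
    have t: "\<epsilon> x i * (c y i - c x i) = t" if "i \<in> I" for i
    proof (cases "i = k")
      case False
      have "v x i = v y i" "\<epsilon> x = \<epsilon> y" using eq by simp_all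
      then have "\<epsilon> x i * (c x i - b i) - \<epsilon> x k * (c x k - b k) = \<epsilon> x i * (c y i - b i) - \<epsilon> x k * (c y k - b k)"
        using that False by (simp add: v_def)
      then show ?thesis unfolding t_def by (simp add: algebra_simps)
    qed (simp add: t_def)
    have sq: "\<epsilon> x i * \<epsilon> x i = 1" if "i \<in> I" for i using that by (simp add: \<epsilon>_def)
    have "\<not> t \<ge> 1" using no[OF xy] t by auto
    \<comment> \<open>Exchange \<open>x\<close> and \<open>y\<close>: they share the sign pattern,
      so \<open>t\<close> changes its sign.\<close>
    moreover have "\<not> t \<le> -1"
    proof
      assume "t \<le> - 1"
      have "\<epsilon> y i * (c x i - c y i) = - t" if "i \<in> I" for i
        using t[OF that] eq by (simp add: algebra_simps)
      then show False using no[OF xy(2,1)] \<open>t \<le> -1\<close> by auto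
    qed
    ultimately have "t = 0" by linarith
    have "c y i = c x i" if "i \<in> I" for i
      using t[OF that] sq[OF that] \<open>t = 0\<close> by auto
    then show "c x = c y" by (auto simp: c_def restrict_def)
  qed
  also have "card ?F = 2 ^ card I * (4 * q) ^ (card I - 1)"
  proof -
    have "nat (4 * int q) = 4 * q" by linarith
    then show ?thesis using I k
      by (simp add: card_cartesian_product card_PiE power_mult_distrib numeral_2_eq_2)
  qed
  finally show ?thesis .
qed

text \<open>The first two factors come from the count in convex position in the coordinates of
  \<open>I\<close>, apart from the power of the side. The last one counts the cells over one such
  cell: there every coordinate varies by at most \<open>d * 2 ^ d + 1\<close> cells in either
  direction.\<close>

definition cell_const :: "nat \<Rightarrow> nat" where
  "cell_const d = 2 ^ d * 4 ^ d * (2 * (d * 2 ^ d + 1) + 1) ^ d"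

lemma floor_scale_bounds:
  fixes a :: real
  assumes "h \<le> g"
  shows "\<lfloor>a * 2 ^ h / r\<rfloor> * 2 ^ (g - h) \<le> \<lfloor>a * 2 ^ g / r\<rfloor>"
    and "\<lfloor>a * 2 ^ g / r\<rfloor> < \<lfloor>a * 2 ^ h / r\<rfloor> * 2 ^ (g - h) + 2 ^ (g - h)"
proof -
  have eq: "a * 2 ^ g / r = (a * 2 ^ h / r) * 2 ^ (g - h)"
    using assms by (simp add: power_add[symmetric])
  have "of_int \<lfloor>a * 2 ^ h / r\<rfloor> * 2 ^ (g - h) \<le> (a * 2 ^ h / r) * 2 ^ (g - h)"
    by (intro mult_right_mono) auto
  then show "\<lfloor>a * 2 ^ h / r\<rfloor> * 2 ^ (g - h) \<le> \<lfloor>a * 2 ^ g / r\<rfloor>"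
    unfolding eq le_floor_iff by simp
  have "(a * 2 ^ h / r) * 2 ^ (g - h) < (of_int \<lfloor>a * 2 ^ h / r\<rfloor> + 1) * 2 ^ (g - h)"
    by (intro mult_strict_right_mono) auto
  then show "\<lfloor>a * 2 ^ g / r\<rfloor> < \<lfloor>a * 2 ^ h / r\<rfloor> * 2 ^ (g - h) + 2 ^ (g - h)"
    unfolding eq floor_less_iff by (simp add: algebra_simps)
qed

text \<open>A point \<open>x\<close> of a sphere with centre \<open>x0\<close> has the supporting
  functional \<open>x - x0\<close>, since its product with \<open>y - x\<close> is minus half the
  squared distance from \<open>x\<close> to \<open>y\<close>. Rewritten in the coordinates of
  \<open>I\<close>, which parametrise the flat, it puts the points in convex position, and this
  saves one dimension; the bounded coefficients \<open>\<gamma>\<close> control the other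
  coordinates.\<close>

lemma card_cells_on_sphere:
  assumes free: "affinely_free d p ys" and ne: "ys \<noteq> []"
    and X: "X \<subseteq> flat d p ys" "\<And>x. x \<in> X \<Longrightarrow> (\<Sum>j<d. (x j - x0 j)\<^sup>2) = R"
    and hg: "h \<le> g" and cl: "\<And>x. x \<in> X \<Longrightarrow> cell d l h x = a"
  shows "card (cell d l g ` X) \<le> cell_const d * (2 ^ (g - h)) ^ (length ys - 1)"
proof -
  obtain I \<gamma> where I: "I \<subseteq> {..<d}" "card I = length ys"
    and \<gamma>: "\<And>j i. \<bar>\<gamma> j i :: real\<bar> \<le> 2 ^ length ys"
    and fl: "\<And>x. x \<in> flat d p ys \<longleftrightarrow> (\<forall>j<d. x j - p j = (\<Sum>i\<in>I. \<gamma> j i * (x i - p i)))"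
    using flat_coordinates[OF free] by blast
  have finI: "finite I" using I finite_subset by blast
  have Ine: "I \<noteq> {}" using I(2) ne by auto
  have kd: "length ys \<le> d" using length_le_of_affinely_free[OF free] .
  have diff: "y j - x j = (\<Sum>i\<in>I. \<gamma> j i * (y i - x i))" if "x \<in> X" "y \<in> X" "j < d" for x y j
  proof -
    have "y j - x j = (y j - p j) - (x j - p j)" by simp
    also have "\<dots> = (\<Sum>i\<in>I. \<gamma> j i * (y i - p i)) - (\<Sum>i\<in>I. \<gamma> j i * (x i - p i))"
    proof -
      have "x \<in> flat d p ys" "y \<in> flat d p ys" using that X(1) by auto
      then show ?thesis using fl[of x] fl[of y] \<open>j < d\<close> by metis
    qed
    also have "\<dots> = (\<Sum>i\<in>I. \<gamma> j i * (y i - x i))"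
      by (simp add: sum_subtractf[symmetric] algebra_simps)
    finally show ?thesis .
  qed
  define s where "s = (2::real) ^ l / 2 ^ g"
  have s: "s > 0" by (simp add: s_def)
  have cs: "cell d l g x = (\<lambda>j\<in>{..<d}. \<lfloor>x j / s\<rfloor>)" for x by (simp add: cell_def s_def)
  define c where "c x = (\<lambda>i\<in>I. \<lfloor>x i / s\<rfloor>)" for x :: "nat \<Rightarrow> real"
  have cI: "card (c ` X) \<le> 2 ^ card I * (4 * 2 ^ (g - h)) ^ (card I - 1)"
    unfolding c_def
  proof (rule card_cells_convex_position[OF finI Ine s, where b = "\<lambda>i. a i * 2 ^ (g - h)"])
    fix x assume x: "x \<in> X"
    define w where "w i = (\<Sum>j<d. (x j - x0 j) * \<gamma> j i)" for i
    show "\<exists>w. \<forall>y\<in>X. (\<lambda>i\<in>I. \<lfloor>y i / s\<rfloor>) \<noteq> (\<lambda>i\<in>I. \<lfloor>x i / s\<rfloor>) \<longrightarrow>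
        (\<Sum>i\<in>I. w i * (y i - x i)) < 0"
    proof (intro exI[of _ w] ballI impI)
      fix y assume y: "y \<in> X" and ne: "(\<lambda>i\<in>I. \<lfloor>y i / s\<rfloor>) \<noteq> (\<lambda>i\<in>I. \<lfloor>x i / s\<rfloor>)"
      have "\<exists>k\<in>I. y k \<noteq> x k"
      proof (rule ccontr)
        assume "\<not> ?thesis"
        then have "(\<lambda>i\<in>I. \<lfloor>y i / s\<rfloor>) = (\<lambda>i\<in>I. \<lfloor>x i / s\<rfloor>)" by (intro restrict_ext) simp
        then show False using ne by contradiction
      qed
      then obtain k where k: "k \<in> I" "y k \<noteq> x k" by blast
      have "(\<Sum>i\<in>I. w i * (y i - x i)) = (\<Sum>j<d. (x j - x0 j) * (\<Sum>i\<in>I. \<gamma> j i * (y i - x i)))"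
        unfolding w_def sum_distrib_right sum_distrib_left
        by (subst sum.swap) (simp add: mult.assoc)
      also have "\<dots> = (\<Sum>j<d. (x j - x0 j) * (y j - x j))"
        by (rule sum.cong) (use diff[OF x y] in auto)
      also have "\<dots> = (\<Sum>j<d. ((y j - x0 j)\<^sup>2 - (x j - x0 j)\<^sup>2 - (y j - x j)\<^sup>2) / 2)"
        by (rule sum.cong) (auto simp: power2_eq_square algebra_simps)
      also have "\<dots> = - (\<Sum>j<d. (y j - x j)\<^sup>2) / 2"
        using X(2)[OF x] X(2)[OF y] by (simp add: sum_divide_distrib[symmetric] sum_subtractf)
      finally have "(\<Sum>i\<in>I. w i * (y i - x i)) = - (\<Sum>j<d. (y j - x j)\<^sup>2) / 2" .
      moreover have "(\<Sum>j<d. (y j - x j)\<^sup>2) > 0"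
        using k I by (intro sum_pos2[of _ k]) auto
      ultimately show "(\<Sum>i\<in>I. w i * (y i - x i)) < 0" by simp
    qed
    fix i assume i: "i \<in> I"
    then have "i < d" using I by auto
    have ai: "a i = \<lfloor>x i * 2 ^ h / 2 ^ l\<rfloor>" using cl[OF x] \<open>i < d\<close> by (auto simp: cell_def)
    show "a i * 2 ^ (g - h) \<le> (\<lambda>i\<in>I. \<lfloor>x i / s\<rfloor>) i \<and>
        (\<lambda>i\<in>I. \<lfloor>x i / s\<rfloor>) i < a i * 2 ^ (g - h) + int (2 ^ (g - h))"
      using floor_scale_bounds[OF hg, of "x i" "2 ^ l"] i unfolding ai s_def by simp
  qed
  define D where "D = int (d * 2 ^ d + 1)"
  have fib: "card (cell d l g ` {y \<in> X. c y = c x}) \<le> (2 * (d * 2 ^ d + 1) + 1) ^ d" if x: "x \<in> X" for x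
  proof -
    have near: "\<bar>\<lfloor>y j / s\<rfloor> - \<lfloor>x j / s\<rfloor>\<bar> \<le> D" if y: "y \<in> X" "c y = c x" and j: "j < d" for y j
    proof -
      have "\<bar>\<gamma> j i * (y i - x i)\<bar> \<le> 2 ^ d * s" if i: "i \<in> I" for i
      proof -
        have "\<lfloor>y i / s\<rfloor> = \<lfloor>x i / s\<rfloor>" using fun_cong[OF y(2), of i] i by (simp add: c_def)
        then have "\<bar>y i / s - x i / s\<bar> \<le> 1" by linarith
        then have "\<bar>y i - x i\<bar> \<le> s"
          using s by (simp add: diff_divide_distrib[symmetric] abs_divide)
        moreover have "\<bar>\<gamma> j i\<bar> \<le> 2 ^ d"
          using \<gamma>[of j i] power_increasing[OF kd, of "2::real"] by linarith
        ultimately show ?thesis unfolding abs_mult by (intro mult_mono) auto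
      qed
      then have "\<bar>\<Sum>i\<in>I. \<gamma> j i * (y i - x i)\<bar> \<le> (\<Sum>i\<in>I. 2 ^ d * s)"
        by (intro order.trans[OF sum_abs] sum_mono)
      also have "\<dots> = real (card I) * (2 ^ d * s)" by simp
      also have "\<dots> \<le> real d * (2 ^ d * s)"
        using kd I(2) s by (intro mult_right_mono) auto
      finally have "\<bar>y j - x j\<bar> \<le> real d * 2 ^ d * s"
        using diff[OF x y(1) j] by (simp add: mult.assoc)
      then have "\<bar>y j / s - x j / s\<bar> \<le> real d * 2 ^ d"
        using s by (simp add: diff_divide_distrib[symmetric] abs_divide pos_divide_le_eq)
      moreover have "real d * 2 ^ d = of_int (int (d * 2 ^ d))" by simp
      ultimately show ?thesis unfolding D_def by linarith
    qed
    let ?P = "{..<d} \<rightarrow>\<^sub>E {- D..D}"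
    have "card (cell d l g ` {y \<in> X. c y = c x}) \<le> card ?P"
    proof (rule card_image_le_of_factor[of _ "\<lambda>y. \<lambda>j\<in>{..<d}. \<lfloor>y j / s\<rfloor> - \<lfloor>x j / s\<rfloor>"])
      show "finite ?P" by (intro finite_PiE) auto
      show "(\<lambda>y. \<lambda>j\<in>{..<d}. \<lfloor>y j / s\<rfloor> - \<lfloor>x j / s\<rfloor>) ` {y \<in> X. c y = c x} \<subseteq> ?P"
      proof (intro image_subsetI PiE_I)
        fix y j assume "y \<in> {y \<in> X. c y = c x}" "j \<in> {..<d}"
        then have "\<bar>\<lfloor>y j / s\<rfloor> - \<lfloor>x j / s\<rfloor>\<bar> \<le> D" using near by simp
        then show "(\<lambda>j\<in>{..<d}. \<lfloor>y j / s\<rfloor> - \<lfloor>x j / s\<rfloor>) j \<in> {- D..D}"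
          using \<open>j \<in> {..<d}\<close> by (simp add: abs_le_iff minus_le_iff)
      qed simp
    next
      fix y z
      assume eq: "(\<lambda>j\<in>{..<d}. \<lfloor>y j / s\<rfloor> - \<lfloor>x j / s\<rfloor>) = (\<lambda>j\<in>{..<d}. \<lfloor>z j / s\<rfloor> - \<lfloor>x j / s\<rfloor>)"
      show "cell d l g y = cell d l g z"
        unfolding cs
      proof (rule restrict_ext)
        fix j assume "j \<in> {..<d}"
        then show "\<lfloor>y j / s\<rfloor> = \<lfloor>z j / s\<rfloor>" using fun_cong[OF eq, of j] by simp
      qed
    qed
    also have "\<dots> = (2 * (d * 2 ^ d + 1) + 1) ^ d"
    proof -
      have "D + 1 + D = int (2 * (d * 2 ^ d + 1) + 1)" unfolding D_def by simp
      then have "card {- D..D} = 2 * (d * 2 ^ d + 1) + 1"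
        unfolding card_atLeastAtMost_int diff_minus_eq_add by (simp only: nat_int)
      then show ?thesis by (simp only: card_PiE finite_lessThan prod_constant card_lessThan)
    qed
    finally show ?thesis .
  qed
  have fin: "finite (c ` X)"
  proof (rule finite_subset)
    show "c ` X \<subseteq> (\<Pi>\<^sub>E i\<in>I. {a i * 2 ^ (g - h)..<a i * 2 ^ (g - h) + 2 ^ (g - h)})"
    proof (intro image_subsetI PiE_I)
      fix x i assume x: "x \<in> X" and i: "i \<in> I"
      then have "i < d" using I by auto
      have ai: "a i = \<lfloor>x i * 2 ^ h / 2 ^ l\<rfloor>" using cl[OF x] \<open>i < d\<close> by (auto simp: cell_def)
      show "c x i \<in> {a i * 2 ^ (g - h)..<a i * 2 ^ (g - h) + 2 ^ (g - h)}"
        using floor_scale_bounds[OF hg, of "x i" "2 ^ l"] i unfolding ai s_def c_def by simp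
    qed (simp add: c_def)
    show "finite (\<Pi>\<^sub>E i\<in>I. {a i * 2 ^ (g - h)..<a i * 2 ^ (g - h) + 2 ^ (g - h)})"
      using finI by (intro finite_PiE) auto
  qed
  have "card (cell d l g ` X) \<le> card (c ` X) * (2 * (d * 2 ^ d + 1) + 1) ^ d"
    using fin fib by (rule card_image_le_fibres)
  also have "\<dots> \<le> (2 ^ card I * (4 * 2 ^ (g - h)) ^ (card I - 1)) * (2 * (d * 2 ^ d + 1) + 1) ^ d"
    using cI by (rule mult_right_mono) simp
  also have "\<dots> = (2 ^ length ys * 4 ^ (length ys - 1)) * ((2 ^ (g - h)) ^ (length ys - 1)
      * (2 * (d * 2 ^ d + 1) + 1) ^ d)"
    by (simp add: I power_mult_distrib)
  also have "\<dots> \<le> (2 ^ d * 4 ^ d) * ((2 ^ (g - h)) ^ (length ys - 1) * (2 * (d * 2 ^ d + 1) + 1) ^ d)"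
    using kd by (intro mult_right_mono mult_mono power_increasing) auto
  finally show ?thesis unfolding cell_const_def by (simp add: ac_simps)
qed

section \<open>Chains of points at increasing scales\<close>

text \<open>Both lists have the newest entry first. A cell of level \<open>g\<close> has side \<open>2 ^ (l - g)\<close>, so the
  levels decrease as the chain grows and \<open>last gs\<close> is the largest one.\<close>

fun chain :: "nat \<Rightarrow> nat \<Rightarrow> (nat \<Rightarrow> real) set \<Rightarrow> (nat \<Rightarrow> real) \<Rightarrow> (nat \<Rightarrow> real) list \<Rightarrow> nat list \<Rightarrow> bool"
  where
  "chain d l A p [] [] = True"
| "chain d l A p (y # ys) (g # gs) = (chain d l A p ys gs \<and> y \<in> A \<and> y \<notin> flat d p ys \<and>
     0 < g \<and> g \<le> l \<and> (\<forall>g'\<in>set gs. g \<le> g') \<and> cell d l (g - 1) y = cell d l (g - 1) p \<and>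
     (\<forall>x\<in>A. cell d l g x = cell d l g p \<longrightarrow> x \<in> flat d p ys))"
| "chain d l A p [] (g # gs) = False"
| "chain d l A p (y # ys) [] = False"

lemma chain_length: "chain d l A p ys gs \<Longrightarrow> length ys = length gs"
  by (induction d l A p ys gs rule: chain.induct) auto

lemma chain_affinely_free: "chain d l A p ys gs \<Longrightarrow> affinely_free d p ys"
  by (induction d l A p ys gs rule: chain.induct) auto

lemma chain_points: "chain d l A p ys gs \<Longrightarrow> set ys \<subseteq> A"
  by (induction d l A p ys gs rule: chain.induct) auto

lemma chain_levels: "chain d l A p ys gs \<Longrightarrow> set gs \<subseteq> {1..l} \<and> sorted gs"
  by (induction d l A p ys gs rule: chain.induct) auto

lemma chain_cells:
  "chain d l A p ys gs \<Longrightarrow> list_all2 (\<lambda>y g. y \<in> A \<and> cell d l (g - 1) y = cell d l (g - 1) p) ys gs"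
  by (induction d l A p ys gs rule: chain.induct) auto

text \<open>This keeps the levels monotone: at every earlier level the cell around \<open>p\<close>
  is already captured by the current flat, so the least such level cannot be larger.\<close>

lemma chain_flat_level:
  assumes "chain d l A p ys gs" "g \<in> set gs" "x \<in> A" "cell d l g x = cell d l g p"
  shows "x \<in> flat d p ys"
  using assms
proof (induction d l A p ys gs rule: chain.induct)
  case (2 d l A p y ys g' gs)
  then have "x \<in> flat d p ys" by auto
  then show ?case by (rule flat_Cons_mono)
qed auto

text \<open>Take a chain of maximal length, which exists because affinely free lists have at most
  \<open>d\<close> entries. If its flat missed part of \<open>A\<close>, the least level
  \<open>g\<close> whose cell around \<open>p\<close> stays in the flat would extend it: level
  \<open>l\<close> qualifies because its cell contains only \<open>p\<close>, and level 0 does not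
  because its cell contains all of \<open>A\<close>.\<close>

lemma chain_complete_exists:
  assumes p: "p \<in> A"
    and sep: "inj_on (cell d l l) A" and top: "\<And>x. x \<in> A \<Longrightarrow> cell d l 0 x = cell d l 0 p"
  shows "\<exists>ys gs. chain d l A p ys gs \<and> A \<subseteq> flat d p ys"
proof -
  let ?P = "\<lambda>m. \<exists>ys gs. chain d l A p ys gs \<and> length ys = m"
  have "?P 0" by (intro exI[of _ "[]"]) simp
  moreover have "\<forall>m. ?P m \<longrightarrow> m \<le> d"
    using chain_affinely_free length_le_of_affinely_free by blast
  ultimately have "\<exists>m. ?P m \<and> (\<forall>k. ?P k \<longrightarrow> k \<le> m)"
    by (rule Nat.ex_has_greatest_nat)
  then obtain m where m: "?P m \<and> (\<forall>k. ?P k \<longrightarrow> k \<le> m)" ..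
  from m[THEN conjunct1] obtain ys gs where ch: "chain d l A p ys gs" and len: "length ys = m"
    by blast
  have mx: "length ys' \<le> length ys" if "chain d l A p ys' gs'" for ys' gs'
    using m[THEN conjunct2] that len by metis
  have "A \<subseteq> flat d p ys"
  proof (rule ccontr)
    assume nsub: "\<not> A \<subseteq> flat d p ys"
    let ?Q = "\<lambda>h. \<forall>x\<in>A. cell d l h x = cell d l h p \<longrightarrow> x \<in> flat d p ys"
    have Ql: "?Q l" using inj_onD[OF sep _ _ p] base_in_flat by blast
    define g where "g = (LEAST h. ?Q h)"
    have Qg: "?Q g" unfolding g_def using Ql by (rule LeastI)
    have gl: "g \<le> l" unfolding g_def using Ql by (rule Least_le)
    have "\<not> ?Q 0" using nsub top by blast
    then have g0: "0 < g" using Qg by (cases g) auto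
    then have "\<not> ?Q (g - 1)" using not_less_Least[of "g - 1" ?Q] unfolding g_def by simp
    then obtain y where y: "y \<in> A" "cell d l (g - 1) y = cell d l (g - 1) p" "y \<notin> flat d p ys"
      by blast
    have "g \<le> g'" if "g' \<in> set gs" for g'
      unfolding g_def using chain_flat_level[OF ch that] by (intro Least_le) blast
    then have "chain d l A p (y # ys) (g # gs)" unfolding chain.simps using ch y g0 gl Qg by blast
    from mx[OF this] show False by simp
  qed
  then show ?thesis using ch by blast
qed

text \<open>Induction from the coarsest level on. In one cell of level \<open>h\<close> the set
  \<open>E\<close> lies on a sphere in a flat of dimension \<open>length gs\<close>, so it meets O(2
  ^ ((g - h) * (length gs - 1))) cells of the next level \<open>g = hd gs\<close>; in each of those
  the points lie in a flat of one dimension less and the tail of \<open>gs\<close> applies. The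
  power of 2 on the left makes the exponents telescope and leaves one factor \<open>2 ^ g\<close>
  for each level but the last.\<close>

lemma card_chain_points:
  assumes sphere: "\<And>x. x \<in> A \<Longrightarrow> (\<Sum>j<d. (x j - x0 j)\<^sup>2) = R"
    and sep: "inj_on (cell d l l) A"
  shows "gs \<noteq> [] \<Longrightarrow> finite E \<Longrightarrow> E \<subseteq> A \<Longrightarrow> h \<le> hd gs \<Longrightarrow> (\<And>x. x \<in> E \<Longrightarrow> cell d l h x = a) \<Longrightarrow>
    (\<And>p. p \<in> E \<Longrightarrow> \<exists>ys. chain d l A p ys gs \<and>
      (\<forall>x\<in>A. cell d l h x = cell d l h p \<longrightarrow> x \<in> flat d p ys)) \<Longrightarrow>
    2 ^ (h * (length gs - 1)) * card E \<le> cell_const d ^ length gs * 2 ^ sum_list (butlast gs)"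
proof (induction gs arbitrary: E h a)
  case (Cons g gs)
  show ?case
  proof (cases "E = {}")
    case False
    then obtain p where pE: "p \<in> E" by auto
    then obtain ys where ch: "chain d l A p ys (g # gs)"
      and fl: "\<forall>x\<in>A. cell d l h x = cell d l h p \<longrightarrow> x \<in> flat d p ys"
      using Cons.prems(6) by blast
    have Efl: "E \<subseteq> flat d p ys" using fl Cons.prems(3,5) pE by auto
    have len: "length ys = Suc (length gs)" using chain_length[OF ch] by simp
    then have ysne: "ys \<noteq> []" by auto
    have hg: "h \<le> g" using Cons.prems(4) by simp
    have gl: "g \<le> l" using chain_levels[OF ch] by auto
    have cells: "card (cell d l g' ` E) \<le> cell_const d * (2 ^ (g' - h)) ^ length gs" if "h \<le> g'" for g'
      using card_cells_on_sphere[OF chain_affinely_free[OF ch] ysne Efl _ that Cons.prems(5), of x0 R]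
        sphere Cons.prems(3) len by auto
    show ?thesis
    \<comment> \<open>In a flat of dimension 1 the number of cells does not depend on the scale, so
      one passes directly to level \<open>l\<close>, where cells separate the points. Hence the last
      level contributes no power of 2.\<close>
    proof (cases "gs = []")
      case True
      have "card (cell d l l ` E) = card E"
        using inj_on_subset[OF sep Cons.prems(3)] by (rule card_image)
      moreover have "card (cell d l l ` E) \<le> cell_const d"
        using cells[of l] hg gl True by simp
      ultimately show ?thesis using True by simp
    next
      case False
      define c where "c = (2::nat) ^ (g * (length gs - 1))"
      define B where "B = cell_const d ^ length gs * 2 ^ sum_list (butlast gs)"
      have "card {y \<in> E. cell d l g y = cell d l g x} \<le> B div c" if x: "x \<in> E" for x
      proof -
        have "c * card {y \<in> E. cell d l g y = cell d l g x} \<le> B"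
          unfolding c_def B_def
        proof (rule Cons.IH[OF False, where a = "cell d l g x"])
          show "finite {y \<in> E. cell d l g y = cell d l g x}" using Cons.prems(2) by simp
          show "{y \<in> E. cell d l g y = cell d l g x} \<subseteq> A" using Cons.prems(3) by auto
          show "g \<le> hd gs" using chain_levels[OF ch] False by simp
          fix q assume "q \<in> {y \<in> E. cell d l g y = cell d l g x}"
          then have "q \<in> E" by simp
          then obtain zs where zs: "chain d l A q zs (g # gs)" using Cons.prems(6) by blast
          then obtain z zs' where "zs = z # zs'" by (cases zs) simp_all
          then show "\<exists>ys. chain d l A q ys gs \<and>
              (\<forall>x\<in>A. cell d l g x = cell d l g q \<longrightarrow> x \<in> flat d q ys)"
            using zs by (intro exI[of _ zs']) simp
        qed simp
        moreover have "c > 0" by (simp add: c_def)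
        ultimately show ?thesis by (simp only: less_eq_div_iff_mult_less_eq mult.commute)
      qed
      then have "card (id ` E) \<le> card (cell d l g ` E) * (B div c)"
        using Cons.prems(2) by (intro card_image_le_fibres) auto
      then have "c * card E \<le> card (cell d l g ` E) * (c * (B div c))"
        by (simp add: mult.left_commute)
      also have "\<dots> \<le> (cell_const d * (2 ^ (g - h)) ^ length gs) * B"
        using cells[OF hg] by (intro mult_mono times_div_less_eq_dividend) simp_all
      finally have le: "c * card E \<le> cell_const d * (2 ^ (g - h)) ^ length gs * B" .
      obtain k where k: "length gs = Suc k" using False by (cases gs) auto
      \<comment> \<open>The two scales combine to \<open>2 ^ (g * length gs)\<close>, one factor
        \<open>2 ^ g\<close> more than the induction hypothesis absorbs.\<close>
      have pow: "(2::nat) ^ (h * length gs) * (2 ^ (g - h)) ^ length gs = c * 2 ^ g"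
      proof -
        have "(2::nat) ^ (h * length gs) * (2 ^ (g - h)) ^ length gs = (2 ^ h * 2 ^ (g - h)) ^ length gs"
          by (simp only: power_mult power_mult_distrib)
        also have "(2::nat) ^ h * 2 ^ (g - h) = 2 ^ g"
          using hg by (simp only: power_add[symmetric] le_add_diff_inverse)
        also have "((2::nat) ^ g) ^ length gs = c * 2 ^ g"
          by (simp only: c_def k power_mult power_Suc2 diff_Suc_1)
        finally show ?thesis .
      qed
      have "c * (2 ^ (h * length gs) * card E) = 2 ^ (h * length gs) * (c * card E)" by simp
      also have "\<dots> \<le> 2 ^ (h * length gs) * (cell_const d * (2 ^ (g - h)) ^ length gs * B)"
        using le by simp
      also have "\<dots> = cell_const d * (2 ^ (h * length gs) * (2 ^ (g - h)) ^ length gs) * B" by simp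
      also have "\<dots> = c * (cell_const d * B * 2 ^ g)" unfolding pow by simp
      finally have "2 ^ (h * length gs) * card E \<le> cell_const d * B * 2 ^ g"
        by (rule mult_left_le_imp_le) (simp add: c_def)
      also have "\<dots> = cell_const d ^ length (g # gs) * 2 ^ sum_list (butlast (g # gs))"
        using False by (simp add: B_def power_add)
      finally show ?thesis by simp
    qed
  qed simp
qed simp

section \<open>Spheres determined by the points of a chain\<close>

lemma linear_form_on_flat:
  assumes "x \<in> flat d p ys" "(\<Sum>j<d. b j * p j) = e" "\<And>y. y \<in> set ys \<Longrightarrow> (\<Sum>j<d. b j * y j) = e"
  shows "(\<Sum>j<d. b j * x j) = (e::real)"
  using assms
proof (induction ys arbitrary: x)
  case Nil
  then have "(\<Sum>j<d. b j * x j) = (\<Sum>j<d. b j * p j)" by (intro sum.cong) auto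
  then show ?case using Nil by simp
next
  case (Cons y ys)
  then obtain c where "(\<lambda>j. x j - c * (y j - p j)) \<in> flat d p ys" by auto
  then have "(\<Sum>j<d. b j * (x j - c * (y j - p j))) = e" using Cons by auto
  moreover have "(\<Sum>j<d. b j * (x j - c * (y j - p j)))
      = (\<Sum>j<d. b j * x j) - c * ((\<Sum>j<d. b j * y j) - (\<Sum>j<d. b j * p j))"
    by (simp add: algebra_simps sum_subtractf sum.distrib sum_distrib_left)
  ultimately show ?case using Cons.prems by simp
qed

text \<open>The quadratic terms cancel in the difference of two sphere equations. What remains is an
  affine form that is constant on \<open>p\<close> and \<open>ys\<close>, hence on their flat. So
  sections that lie in this flat and share \<open>p\<close> and the picked points contain each
  other.\<close>

lemma sphere_determined_on_flat:
  assumes x: "x \<in> flat d p ys"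
    and R: "\<And>y. y \<in> insert x (insert p (set ys)) \<Longrightarrow> (\<Sum>j<d. (y j - x0 j)\<^sup>2) = R"
    and S: "\<And>y. y \<in> insert p (set ys) \<Longrightarrow> (\<Sum>j<d. (y j - x1 j)\<^sup>2) = S"
  shows "(\<Sum>j<d. (x j - x1 j)\<^sup>2) = (S::real)"
proof -
  define b where "b j = 2 * (x1 j - x0 j)" for j
  define e where "e = (\<Sum>j<d. (x1 j)\<^sup>2 - (x0 j)\<^sup>2)"
  have eq: "(\<Sum>j<d. (y j - x0 j)\<^sup>2) - (\<Sum>j<d. (y j - x1 j)\<^sup>2) = (\<Sum>j<d. b j * y j) - e" for y
    unfolding b_def e_def sum_subtractf[symmetric]
    by (rule sum.cong) (auto simp: power2_eq_square algebra_simps)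
  have "(\<Sum>j<d. b j * x j) = R - S + e"
  proof (rule linear_form_on_flat[OF x])
    show "(\<Sum>j<d. b j * p j) = R - S + e" using R[of p] S[of p] eq[of p] by simp
    show "(\<Sum>j<d. b j * y j) = R - S + e" if "y \<in> set ys" for y
      using R[of y] S[of y] eq[of y] that by simp
  qed
  then show ?thesis using eq[of x] R[of x] by simp
qed

section \<open>Dyadic cells of the grid\<close>

lemma finite_grid: "finite (grid d n)"
  unfolding grid_def by (intro finite_PiE) auto

lemma card_grid: "card (grid d n) = n ^ d"
  unfolding grid_def by (simp add: card_PiE card_image)

lemma inj_on_cell_grid: "inj_on (cell d l l) (grid d n)"
proof (rule inj_onI)
  fix x y assume x: "x \<in> grid d n" and y: "y \<in> grid d n" and eq: "cell d l l x = cell d l l y"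
  show "x = y"
  proof (rule PiE_ext[OF x[unfolded grid_def] y[unfolded grid_def]])
    fix j assume j: "j \<in> {..<d}"
    have "\<lfloor>x j\<rfloor> = \<lfloor>y j\<rfloor>" using fun_cong[OF eq, of j] j by (simp add: cell_def)
    moreover have "x j \<in> real ` {1..n}" "y j \<in> real ` {1..n}"
      using x y j by (auto simp: grid_def PiE_iff)
    ultimately show "x j = y j" by auto
  qed
qed

lemma cell_0_grid:
  assumes "x \<in> grid d n" "n < 2 ^ l"
  shows "cell d l 0 x = (\<lambda>j\<in>{..<d}. 0)"
  unfolding cell_def
proof (rule restrict_ext)
  fix j assume "j \<in> {..<d}"
  then have "x j \<in> real ` {1..n}" using assms(1) by (auto simp: grid_def PiE_iff)
  then obtain m where "m \<le> n" "x j = real m" by auto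
  moreover have "real m < 2 ^ l" using assms(2) \<open>m \<le> n\<close>
    by (metis le_less_trans of_nat_less_numeral_power_cancel_iff)
  ultimately show "\<lfloor>x j * 2 ^ 0 / 2 ^ l\<rfloor> = 0" by (simp add: floor_eq_iff)
qed

lemma card_grid_cell:
  assumes "h \<le> l"
  shows "card {y \<in> grid d n. cell d l h y = a} \<le> (2 ^ (l - h)) ^ d"
proof -
  let ?S = "\<lambda>j. real_of_int ` {a j * 2 ^ (l - h)..<a j * 2 ^ (l - h) + 2 ^ (l - h)}"
  have "{y \<in> grid d n. cell d l h y = a} \<subseteq> PiE {..<d} ?S"
  proof (intro subsetI PiE_I)
    fix y j assume y: "y \<in> {y \<in> grid d n. cell d l h y = a}" and j: "j \<in> {..<d}"
    then have "y j \<in> real ` {1..n}" by (auto simp: grid_def PiE_iff)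
    then have yj: "y j = real_of_int \<lfloor>y j\<rfloor>" by auto
    have aj: "a j = \<lfloor>y j * 2 ^ h / 2 ^ l\<rfloor>" using y j by (auto simp: cell_def)
    have "\<lfloor>y j\<rfloor> \<in> {a j * 2 ^ (l - h)..<a j * 2 ^ (l - h) + 2 ^ (l - h)}"
      using floor_scale_bounds[OF assms, of "y j" "2 ^ l"] unfolding aj by simp
    then show "y j \<in> ?S j" using yj by (metis imageI)
  qed (auto simp: grid_def PiE_iff extensional_def)
  then have "card {y \<in> grid d n. cell d l h y = a} \<le> card (PiE {..<d} ?S)"
    by (intro card_mono finite_PiE) auto
  also have "\<dots> = (\<Prod>j<d. card (?S j))" by (simp add: card_PiE)
  also have "\<dots> = (2 ^ (l - h)) ^ d"
    by (simp add: card_image inj_on_def nat_power_eq)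
  finally show ?thesis .
qed

text \<open>The number of lists is at most the product of \<open>2 ^ (d * (l + 1 - g))\<close> over
  the levels \<open>g\<close>, as a picked point ranges over a cell of level \<open>g - 1\<close>.
  Multiplying out avoids subtraction in the exponent.\<close>

lemma card_cell_lists:
  fixes d l n p
  defines "W \<equiv> \<lambda>gs. {ys. list_all2 (\<lambda>y g. y \<in> grid d n \<and> cell d l (g - 1) y = cell d l (g - 1) p) ys gs}"
  assumes "set gs \<subseteq> {1..l}"
  shows "finite (W gs) \<and> card (W gs) * 2 ^ (d * sum_list gs) \<le> 2 ^ (d * (l + 1) * length gs)"
  using assms(2)
proof (induction gs)
  case Nil
  then show ?case by (simp add: W_def)
next
  case (Cons g gs)
  let ?G = "{y \<in> grid d n. cell d l (g - 1) y = cell d l (g - 1) p}"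
  have W: "W (g # gs) = (\<lambda>(y, ys). y # ys) ` (?G \<times> W gs)"
    unfolding W_def by (auto simp: list_all2_Cons2 image_iff)
  have fin: "finite (?G \<times> W gs)" using Cons finite_grid by auto
  have "card (W (g # gs)) \<le> card ?G * card (W gs)"
    unfolding W using card_image_le[OF fin] by (simp add: card_cartesian_product)
  also have "\<dots> \<le> (2 ^ (l - (g - 1))) ^ d * card (W gs)"
    using Cons.prems by (intro mult_right_mono card_grid_cell) auto
  finally have "card (W (g # gs)) * 2 ^ (d * g) \<le> (2 ^ (l - (g - 1))) ^ d * card (W gs) * 2 ^ (d * g)"
    by simp
  also have "\<dots> = 2 ^ (d * (l + 1)) * card (W gs)"
  proof -
    have "(2 ^ (l - (g - 1))) ^ d * 2 ^ (d * g) = (2::nat) ^ (d * (l - (g - 1) + g))"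
      by (simp add: power_mult[symmetric] power_add[symmetric] algebra_simps)
    moreover have "l - (g - 1) + g = l + 1" using Cons.prems by auto
    ultimately show ?thesis by (metis mult.assoc mult.commute)
  qed
  finally have "card (W (g # gs)) * 2 ^ (d * g) * 2 ^ (d * sum_list gs)
      \<le> 2 ^ (d * (l + 1)) * (card (W gs) * 2 ^ (d * sum_list gs))"
    by simp
  also have "\<dots> \<le> 2 ^ (d * (l + 1)) * 2 ^ (d * (l + 1) * length gs)"
    using Cons by (intro mult_left_mono) auto
  finally have "card (W (g # gs)) * 2 ^ (d * sum_list (g # gs)) \<le> 2 ^ (d * (l + 1) * length (g # gs))"
    by (simp add: power_add[symmetric] algebra_simps)
  then show ?case using W fin by simp
qed

section \<open>The upper bound\<close>

lemma exists_dyadic_scale: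
  assumes "n \<ge> 1"
  shows "\<exists>l. n < 2 ^ l \<and> 2 ^ l \<le> 2 * (n::nat)"
proof -
  define l where "l = (LEAST l. n < 2 ^ l)"
  have ex: "n < 2 ^ n" by (rule less_exp)
  have l: "n < 2 ^ l" unfolding l_def using ex by (rule LeastI)
  then have "l \<noteq> 0" using assms by (cases "l = 0") auto
  then obtain k where k: "l = Suc k" by (cases l) auto
  then have "\<not> n < 2 ^ k" using not_less_Least[of k "\<lambda>l. n < 2 ^ l"] unfolding l_def by simp
  then show ?thesis using l k by (intro exI[of _ l]) simp
qed

text \<open>Spheres with the same trace on the grid count once. Having two points forces every
  complete chain to pick a point.\<close>

definition spherical_sections :: "nat \<Rightarrow> nat \<Rightarrow> (nat \<Rightarrow> real) set set" where
  "spherical_sections d n =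
     {A. 2 \<le> card A \<and> (\<exists>x0 R. A = {x \<in> grid d n. (\<Sum>j<d. (x j - x0 j)\<^sup>2) = R})}"

definition chain_class :: "nat \<Rightarrow> nat \<Rightarrow> (nat \<Rightarrow> real) set \<Rightarrow> nat list \<Rightarrow> (nat \<Rightarrow> real) set" where
  "chain_class d l A gs = {p \<in> A. \<exists>ys. chain d l A p ys gs \<and> A \<subseteq> flat d p ys}"

definition level_lists :: "nat \<Rightarrow> nat \<Rightarrow> nat list set" where
  "level_lists d l =
     {gs. gs \<noteq> [] \<and> length gs \<le> d \<and> set gs \<subseteq> {1..l} \<and> (\<forall>g\<in>set gs. g \<le> last gs)}"

lemma spherical_sections_subset: "A \<in> spherical_sections d n \<Longrightarrow> A \<subseteq> grid d n"
  by (auto simp: spherical_sections_def)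

lemma finite_spherical_section: "A \<in> spherical_sections d n \<Longrightarrow> finite A"
  by (rule finite_subset[OF spherical_sections_subset finite_grid])

lemma finite_spherical_sections: "finite (spherical_sections d n)"
proof (rule finite_subset)
  show "spherical_sections d n \<subseteq> Pow (grid d n)" using spherical_sections_subset by blast
qed (simp add: finite_grid)

lemma chain_class_subset: "chain_class d l A gs \<subseteq> A"
  by (auto simp: chain_class_def)

lemma finite_level_lists: "finite (level_lists d l)"
proof (rule finite_subset)
  show "level_lists d l \<subseteq> {gs. set gs \<subseteq> {1..l} \<and> length gs \<le> d}"
    by (auto simp: level_lists_def)
qed (rule finite_lists_length_le, simp)

text \<open>The case of level \<open>h = 0\<close>: its cell contains the grid, so the flatness
  hypothesis says that the chain is complete.\<close>

lemma card_chain_class: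
  assumes A: "A \<in> spherical_sections d n" and n: "n < 2 ^ l" and ne: "gs \<noteq> []"
  shows "card (chain_class d l A gs) \<le> cell_const d ^ length gs * 2 ^ sum_list (butlast gs)"
proof -
  obtain x0 R where AR: "A = {x \<in> grid d n. (\<Sum>j<d. (x j - x0 j)\<^sup>2) = R}"
    using A by (auto simp: spherical_sections_def)
  have sub: "A \<subseteq> grid d n" using A by (rule spherical_sections_subset)
  have "2 ^ (0 * (length gs - 1)) * card (chain_class d l A gs)
      \<le> cell_const d ^ length gs * 2 ^ sum_list (butlast gs)"
  proof (rule card_chain_points[where R = R and a = "\<lambda>j\<in>{..<d}. 0", OF _ _ ne])
    show "(\<Sum>j<d. (x j - x0 j)\<^sup>2) = R" if "x \<in> A" for x using that AR by simp
    show "inj_on (cell d l l) A" using inj_on_cell_grid sub by (rule inj_on_subset)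
    show "finite (chain_class d l A gs)"
      using chain_class_subset finite_spherical_section[OF A] by (rule finite_subset)
    show "chain_class d l A gs \<subseteq> A" by (rule chain_class_subset)
    show "cell d l 0 x = (\<lambda>j\<in>{..<d}. 0)" if "x \<in> chain_class d l A gs" for x
    proof (rule cell_0_grid[OF _ n])
      show "x \<in> grid d n" using that chain_class_subset sub by blast
    qed
    show "\<exists>ys. chain d l A p ys gs \<and> (\<forall>x\<in>A. cell d l 0 x = cell d l 0 p \<longrightarrow> x \<in> flat d p ys)"
      if "p \<in> chain_class d l A gs" for p
      using that by (auto simp: chain_class_def)
  qed simp
  then show ?thesis by simp
qed

text \<open>Double counting: a pair of a section and a point \<open>p\<close> of its class is
  recovered from \<open>p\<close> and the picked points, which determine the section. The picked
  points are then counted by the cells in which they lie.\<close>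

lemma sum_card_chain_class:
  assumes gs: "set gs \<subseteq> {1..l}"
  shows "(\<Sum>A\<in>spherical_sections d n. card (chain_class d l A gs)) * 2 ^ (d * sum_list gs)
    \<le> n ^ d * 2 ^ (d * (l + 1) * length gs)"
proof -
  let ?\<A> = "spherical_sections d n"
  define W where "W p = {ys. list_all2 (\<lambda>y g. y \<in> grid d n \<and> cell d l (g - 1) y = cell d l (g - 1) p) ys gs}" for p
  have W: "finite (W p)" "card (W p) * 2 ^ (d * sum_list gs) \<le> 2 ^ (d * (l + 1) * length gs)" for p
    using card_cell_lists[OF gs, of d n p] by (simp_all add: W_def)
  define f where "f A p = (SOME ys. chain d l A p ys gs \<and> A \<subseteq> flat d p ys)" for A p
  have f: "chain d l A p (f A p) gs \<and> A \<subseteq> flat d p (f A p)" if "p \<in> chain_class d l A gs" for A p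
    unfolding f_def by (rule someI_ex) (use that in \<open>simp add: chain_class_def\<close>)
  have sub: "A \<subseteq> A'" if A: "A \<in> ?\<A>" "A' \<in> ?\<A>" and p: "p \<in> chain_class d l A gs" "p \<in> chain_class d l A' gs"
    and eq: "f A p = f A' p" for A A' p
  proof
    fix x assume x: "x \<in> A"
    obtain x0 R where AR: "A = {x \<in> grid d n. (\<Sum>j<d. (x j - x0 j)\<^sup>2) = R}"
      using A(1) by (auto simp: spherical_sections_def)
    obtain x1 S where AS: "A' = {x \<in> grid d n. (\<Sum>j<d. (x j - x1 j)\<^sup>2) = S}"
      using A(2) by (auto simp: spherical_sections_def)
    have fA: "set (f A p) \<subseteq> A" "set (f A p) \<subseteq> A'"
      using chain_points[OF f[OF p(1), THEN conjunct1]] chain_points[OF f[OF p(2), THEN conjunct1]]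
      unfolding eq by blast+
    have pA: "p \<in> A" "p \<in> A'" using p chain_class_subset by blast+
    have inA: "insert x (insert p (set (f A p))) \<subseteq> A" "insert p (set (f A p)) \<subseteq> A'"
      using fA pA x by blast+
    have "(\<Sum>j<d. (x j - x1 j)\<^sup>2) = S"
    proof (rule sphere_determined_on_flat)
      show "x \<in> flat d p (f A p)" using f[OF p(1), THEN conjunct2] x by blast
      show "(\<Sum>j<d. (y j - x0 j)\<^sup>2) = R" if "y \<in> insert x (insert p (set (f A p)))" for y
        using subsetD[OF inA(1) that] unfolding AR by blast
      show "(\<Sum>j<d. (y j - x1 j)\<^sup>2) = S" if "y \<in> insert p (set (f A p))" for y
        using subsetD[OF inA(2) that] unfolding AS by blast
    qed
    moreover have "x \<in> grid d n" using x unfolding AR by blast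
    ultimately show "x \<in> A'" unfolding AS by blast
  qed
  have "(\<Sum>A\<in>?\<A>. card (chain_class d l A gs)) = card (SIGMA A:?\<A>. chain_class d l A gs)"
    by (subst card_SigmaI)
      (simp_all add: finite_spherical_sections finite_spherical_section finite_subset[OF chain_class_subset])
  also have "\<dots> \<le> card (SIGMA p:grid d n. W p)"
  proof (rule card_inj_on_le[where f = "\<lambda>(A, p). (p, f A p)"])
    show "inj_on (\<lambda>(A, p). (p, f A p)) (SIGMA A:?\<A>. chain_class d l A gs)"
    proof (rule inj_onI)
      fix u v assume u: "u \<in> (SIGMA A:?\<A>. chain_class d l A gs)" and v: "v \<in> (SIGMA A:?\<A>. chain_class d l A gs)"
        and eq: "(case u of (A, p) \<Rightarrow> (p, f A p)) = (case v of (A, p) \<Rightarrow> (p, f A p))"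
      obtain A p where up: "u = (A, p)" by (cases u)
      obtain A' p' where vp: "v = (A', p')" by (cases v)
      have p': "p' = p" "f A p = f A' p" using eq unfolding up vp by auto
      have "A \<in> ?\<A>" "A' \<in> ?\<A>" "p \<in> chain_class d l A gs" "p \<in> chain_class d l A' gs"
        using u v unfolding up vp p' by simp_all
      then have "A = A'" using sub[of A A' p] sub[of A' A p] p'(2) by (intro equalityI) simp_all
      then show "u = v" unfolding up vp p' by simp
    qed
    show "(\<lambda>(A, p). (p, f A p)) ` (SIGMA A:?\<A>. chain_class d l A gs) \<subseteq> (SIGMA p:grid d n. W p)"
    proof (rule image_subsetI)
      fix u assume u: "u \<in> (SIGMA A:?\<A>. chain_class d l A gs)"
      obtain A p where up: "u = (A, p)" by (cases u)
      have A: "A \<in> ?\<A>" and p: "p \<in> chain_class d l A gs" using u unfolding up by simp_all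
      have "p \<in> grid d n" using p chain_class_subset spherical_sections_subset[OF A] by blast
      moreover have "f A p \<in> W p"
        unfolding W_def mem_Collect_eq
        using chain_cells[OF f[OF p, THEN conjunct1]]
        by (rule list_all2_mono) (use spherical_sections_subset[OF A] in blast)
      ultimately show "(case u of (A, p) \<Rightarrow> (p, f A p)) \<in> (SIGMA p:grid d n. W p)"
        unfolding up by simp
    qed
    show "finite (SIGMA p:grid d n. W p)" by (intro finite_SigmaI finite_grid W(1))
  qed
  also have "\<dots> = (\<Sum>p\<in>grid d n. card (W p))"
    by (subst card_SigmaI) (simp_all add: finite_grid W(1))
  finally have "(\<Sum>A\<in>?\<A>. card (chain_class d l A gs)) * 2 ^ (d * sum_list gs)
      \<le> (\<Sum>p\<in>grid d n. card (W p)) * 2 ^ (d * sum_list gs)"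
    by (rule mult_right_mono) simp
  also have "\<dots> \<le> (\<Sum>p\<in>grid d n. 2 ^ (d * (l + 1) * length gs))"
    unfolding sum_distrib_right by (rule sum_mono) (rule W(2))
  also have "\<dots> = n ^ d * 2 ^ (d * (l + 1) * length gs)" by (simp add: card_grid)
  finally show ?thesis .
qed

lemma sum_power_card_chain_class:
  assumes gs: "gs \<in> level_lists d l" and n: "n < 2 ^ l"
  shows "(\<Sum>A\<in>spherical_sections d n. card (chain_class d l A gs) ^ (d + 2)) * 2 ^ last gs
    \<le> cell_const d ^ (d * (d + 1)) * 2 ^ (d * d) * (2 ^ l) ^ (d * (d + 1))"
proof -
  let ?\<A> = "spherical_sections d n"
  let ?K = "cell_const d"
  have ne: "gs \<noteq> []" and td: "length gs \<le> d" and set: "set gs \<subseteq> {1..l}"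
    and last: "\<forall>g\<in>set gs. g \<le> last gs" using gs by (auto simp: level_lists_def)
  define t a b where "t = length gs" and "a = last gs" and "b = sum_list (butlast gs)"
  define e where "e A = card (chain_class d l A gs)" for A
  have K1: "?K \<ge> 1" by (simp add: cell_const_def)
  have s: "sum_list gs = b + a"
    using ne unfolding a_def b_def by (subst append_butlast_last_id[symmetric, OF ne]) (simp only: sum_list_append, simp)
  have "b \<le> (t - 1) * a"
  proof -
    have "b \<le> sum_list (map (\<lambda>_. a) (butlast gs))"
      unfolding b_def using sum_list_mono[of "butlast gs" "\<lambda>g. g" "\<lambda>_. a"] last
      by (auto simp: a_def dest: in_set_butlastD)
    then show ?thesis by (simp add: sum_list_triv t_def)
  qed
  moreover have "t \<ge> 1" using ne by (cases gs) (auto simp: t_def)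
  ultimately have "b + a \<le> t * a" by (cases t) auto
  also have "\<dots> \<le> d * a" using td by (simp add: t_def)
  finally have ba: "b + a \<le> d * a" .
  have "b * t \<le> b * d" using td by (intro mult_le_mono2) (simp add: t_def)
  then have "b * (t + 1) + a \<le> b * d + (b + a)" by simp
  also have "\<dots> \<le> b * d + d * a" using ba by simp
  \<comment> \<open>The crucial inequality of exponents: on the left the cost of
    \<open>t + 1\<close> factors \<open>2 ^ b\<close> and the desired gain \<open>2 ^ a\<close>, on
    the right the saving from the restricted choice of the picked points.\<close>
  finally have expo: "b * (t + 1) + a \<le> d * (b + a)" by (simp add: algebra_simps)
  have eM: "e A \<le> ?K ^ t * 2 ^ b" if "A \<in> ?\<A>" for A
    unfolding e_def t_def b_def using card_chain_class[OF that n ne] .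
  have nd: "n ^ d \<le> (2 ^ l) ^ d" using n by (intro power_mono) auto
  have eN: "e A \<le> (2 ^ l) ^ d" if "A \<in> ?\<A>" for A
  proof -
    have "e A \<le> card (grid d n)"
      unfolding e_def using chain_class_subset spherical_sections_subset[OF that]
      by (intro card_mono finite_grid) blast
    then show ?thesis using nd by (simp add: card_grid)
  qed
  \<comment> \<open>The exponent splits as \<open>d + 2 = (t + 1) + (d - t) + 1\<close>: the bound
    by levels, the trivial bound, and one factor kept for the double counting.\<close>
  have pw: "e A ^ (d + 2) \<le> (?K ^ t * 2 ^ b) ^ (t + 1) * ((2 ^ l) ^ d) ^ (d - t) * e A" if "A \<in> ?\<A>" for A
  proof -
    have "e A ^ (d + 2) = e A ^ (t + 1) * e A ^ (d - t) * e A"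
      using td by (simp add: power_add[symmetric] t_def flip: power_Suc2)
    also have "\<dots> \<le> (?K ^ t * 2 ^ b) ^ (t + 1) * ((2 ^ l) ^ d) ^ (d - t) * e A"
      using eM[OF that] eN[OF that] by (intro mult_right_mono mult_mono power_mono) auto
    finally show ?thesis .
  qed
  define X where "X = (\<Sum>A\<in>?\<A>. e A ^ (d + 2))"
  have "X \<le> (?K ^ t * 2 ^ b) ^ (t + 1) * ((2 ^ l) ^ d) ^ (d - t) * (\<Sum>A\<in>?\<A>. e A)"
    unfolding X_def sum_distrib_left using pw by (rule sum_mono)
  then have "X * 2 ^ (d * sum_list gs)
      \<le> (?K ^ t * 2 ^ b) ^ (t + 1) * ((2 ^ l) ^ d) ^ (d - t) * ((\<Sum>A\<in>?\<A>. e A) * 2 ^ (d * sum_list gs))"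
    by (metis mult.assoc mult_le_mono1)
  also have "\<dots> \<le> (?K ^ t * 2 ^ b) ^ (t + 1) * ((2 ^ l) ^ d) ^ (d - t) * ((2 ^ l) ^ d * 2 ^ (d * (l + 1) * t))"
    using order.trans[OF sum_card_chain_class[OF set, of d n] mult_right_mono[OF nd]]
    unfolding e_def t_def by (intro mult_left_mono) auto
  also have "\<dots> = ?K ^ (t * (t + 1)) * 2 ^ (d * t) * (2 ^ l) ^ (d * (d + 1)) * 2 ^ (b * (t + 1))"
  proof -
    have e1: "l * d * (d - t) + (l * d + d * (l + 1) * t) = d * t + l * (d * (d + 1))"
    proof -
      obtain r where "d = t + r" using td unfolding t_def by (metis le_iff_add)
      then show ?thesis by (simp add: algebra_simps)
    qed
    have "((2 ^ l) ^ d) ^ (d - t) * ((2 ^ l) ^ d * 2 ^ (d * (l + 1) * t))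
        = (2::nat) ^ (l * d * (d - t) + (l * d + d * (l + 1) * t))"
      by (simp only: power_mult[symmetric] power_add[symmetric])
    also have "\<dots> = 2 ^ (d * t) * (2 ^ l) ^ (d * (d + 1))"
      unfolding e1 by (simp only: power_mult power_add)
    finally have e2: "((2 ^ l) ^ d) ^ (d - t) * ((2 ^ l) ^ d * 2 ^ (d * (l + 1) * t))
        = (2::nat) ^ (d * t) * (2 ^ l) ^ (d * (d + 1))" .
    have "(?K ^ t * 2 ^ b) ^ (t + 1) = ?K ^ (t * (t + 1)) * 2 ^ (b * (t + 1))"
      by (simp only: power_mult_distrib power_mult)
    then show ?thesis using e2 by (simp only: mult.assoc) (simp only: mult.left_commute mult.commute)
  qed
  finally have up: "X * 2 ^ (d * sum_list gs)
      \<le> ?K ^ (t * (t + 1)) * 2 ^ (d * t) * (2 ^ l) ^ (d * (d + 1)) * 2 ^ (b * (t + 1))" .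
  have "X * 2 ^ a * 2 ^ (b * (t + 1)) = X * 2 ^ (b * (t + 1) + a)"
    by (simp add: power_add)
  also have "\<dots> \<le> X * 2 ^ (d * sum_list gs)"
    unfolding s using expo by (intro mult_left_mono power_increasing) auto
  also note up
  finally have "X * 2 ^ a \<le> ?K ^ (t * (t + 1)) * 2 ^ (d * t) * (2 ^ l) ^ (d * (d + 1))"
    by (rule mult_right_le_imp_le) simp
  also have "\<dots> \<le> ?K ^ (d * (d + 1)) * 2 ^ (d * d) * (2 ^ l) ^ (d * (d + 1))"
    using td K1 by (intro mult_right_mono mult_mono power_increasing mult_le_mono) (auto simp: t_def)
  finally show ?thesis by (simp add: X_def e_def a_def)
qed

section \<open>Summation over the lists of levels\<close>

lemma sum_level_lists_le:
  fixes F :: "nat \<Rightarrow> real"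
  assumes F: "\<And>a. F a \<ge> 0"
  shows "(\<Sum>gs\<in>level_lists d l. F (last gs)) \<le> (\<Sum>a\<in>{1..l}. real d * real a ^ d * F a)"
proof -
  have last: "last gs \<in> {1..l}" if "gs \<in> level_lists d l" for gs
    using that last_in_set[of gs] unfolding level_lists_def by blast
  have "(\<Sum>gs\<in>level_lists d l. F (last gs))
      = (\<Sum>a\<in>{1..l}. \<Sum>gs\<in>{gs\<in>level_lists d l. last gs = a}. F (last gs))"
    by (rule sum.group[symmetric]) (use finite_level_lists last in auto)
  also have "\<dots> \<le> (\<Sum>a\<in>{1..l}. real d * real a ^ d * F a)"
  proof (rule sum_mono)
    fix a assume a: "a \<in> {1..l}"
    \<comment> \<open>All entries are at most the last one \<open>a\<close>, so each length gives at
      most \<open>a ^ d\<close> lists, independently of \<open>l\<close>.\<close>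
    have "{gs\<in>level_lists d l. last gs = a} \<subseteq> (\<Union>t\<in>{1..d}. {gs. set gs \<subseteq> {1..a} \<and> length gs = t})"
    proof
      fix gs assume "gs \<in> {gs\<in>level_lists d l. last gs = a}"
      then have "gs \<noteq> []" "length gs \<le> d" "set gs \<subseteq> {1..a}"
        by (auto simp: level_lists_def)
      then show "gs \<in> (\<Union>t\<in>{1..d}. {gs. set gs \<subseteq> {1..a} \<and> length gs = t})"
        by (cases gs) auto
    qed
    then have "card {gs\<in>level_lists d l. last gs = a}
        \<le> card (\<Union>t\<in>{1..d}. {gs. set gs \<subseteq> {1..a} \<and> length gs = t})"
      by (intro card_mono finite_UN_I) (simp_all add: finite_lists_length_eq)
    also have "\<dots> \<le> (\<Sum>t\<in>{1..d}. card {gs. set gs \<subseteq> {1..a} \<and> length gs = t})"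
      by (rule card_UN_le) simp
    also have "\<dots> \<le> (\<Sum>t\<in>{1..d}. a ^ d)"
      using a by (intro sum_mono) (auto simp: card_lists_length_eq intro!: power_increasing)
    finally have "card {gs\<in>level_lists d l. last gs = a} \<le> d * a ^ d" by simp
    then have "real (card {gs\<in>level_lists d l. last gs = a}) \<le> real d * real a ^ d"
      by (metis of_nat_le_iff of_nat_mult of_nat_power)
    then have "real (card {gs\<in>level_lists d l. last gs = a}) * F a \<le> real d * real a ^ d * F a"
      using F by (intro mult_right_mono)
    then show "(\<Sum>gs\<in>{gs\<in>level_lists d l. last gs = a}. F (last gs)) \<le> real d * real a ^ d * F a"
      by simp
  qed
  finally show ?thesis .
qed

lemma sum_le_of_bigo_inverse_square:
  fixes f :: "nat \<Rightarrow> real"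
  assumes "f \<in> O(\<lambda>a. 1 / real a ^ 2)" and "\<And>a. f a \<ge> 0"
  shows "\<exists>C>0. \<forall>l. (\<Sum>a\<in>{1..l}. f a) \<le> C"
proof -
  have "summable (\<lambda>a. 1 / real a ^ 2)" using inverse_power_summable[of 2, where ?'a = real] by (simp add: inverse_eq_divide)
  then have s: "summable f"
    by (intro summable_comparison_test_bigo[OF _ assms(1)]) simp
  \<comment> \<open>The summand 1 makes the bound positive even if \<open>f\<close>
    vanishes.\<close>
  have "(\<Sum>a\<in>{1..l}. f a) \<le> suminf f + 1" for l
    using sum_le_suminf[OF s, of "{1..l}"] assms(2) by simp
  moreover have "suminf f + 1 > 0" using suminf_nonneg[OF s assms(2)] by linarith
  ultimately show ?thesis by blast
qed

text \<open>Every point \<open>p\<close> has a complete chain; its list of levels is not empty,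
  because a chain without picked points would reduce \<open>A\<close> to \<open>p\<close>.\<close>

lemma card_section_le_sum:
  assumes A: "A \<in> spherical_sections d n" and n: "n < 2 ^ l"
  shows "card A \<le> (\<Sum>gs\<in>level_lists d l. card (chain_class d l A gs))"
proof -
  have sub: "A \<subseteq> grid d n" using A by (rule spherical_sections_subset)
  have A2: "2 \<le> card A" using A by (simp add: spherical_sections_def)
  have "A \<subseteq> (\<Union>gs\<in>level_lists d l. chain_class d l A gs)"
  proof
    fix p assume p: "p \<in> A"
    obtain ys gs where ch: "chain d l A p ys gs" and Afl: "A \<subseteq> flat d p ys"
      using chain_complete_exists[OF p, of d l] inj_on_subset[OF inj_on_cell_grid sub]
        cell_0_grid[OF subsetD[OF sub] n] p by metis
    have "gs \<noteq> []"
    proof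
      assume "gs = []"
      then have "ys = []" using chain_length[OF ch] by simp
      have "A \<subseteq> {p}"
      proof
        fix x assume x: "x \<in> A"
        have "x = p"
        proof (rule PiE_ext)
          show "x \<in> {..<d} \<rightarrow>\<^sub>E real ` {1..n}" "p \<in> {..<d} \<rightarrow>\<^sub>E real ` {1..n}"
            using x p sub by (auto simp: grid_def)
          show "x j = p j" if "j \<in> {..<d}" for j using Afl x that \<open>ys = []\<close> by auto
        qed
        then show "x \<in> {p}" by simp
      qed
      then have "card A \<le> 1" using card_mono[of "{p}" A] by simp
      then show False using A2 by simp
    qed
    moreover have "length gs \<le> d"
      using length_le_of_affinely_free[OF chain_affinely_free[OF ch]] chain_length[OF ch] by simp
    moreover have "g \<le> last gs" if g: "g \<in> set gs" for g
    proof -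
      have "sorted (butlast gs @ [last gs])"
        using chain_levels[OF ch] \<open>gs \<noteq> []\<close> by simp
      then have "\<forall>x\<in>set (butlast gs). x \<le> last gs" by (simp only: sorted_append) simp
      moreover have "set gs = insert (last gs) (set (butlast gs))"
        using arg_cong[OF append_butlast_last_id[OF \<open>gs \<noteq> []\<close>], of set] by simp
      ultimately show ?thesis using g by auto
    qed
    ultimately have "gs \<in> level_lists d l"
      using chain_levels[OF ch] by (simp add: level_lists_def)
    moreover have "p \<in> chain_class d l A gs" using p ch Afl by (auto simp: chain_class_def)
    ultimately show "p \<in> (\<Union>gs\<in>level_lists d l. chain_class d l A gs)" by blast
  qed
  moreover have "finite (\<Union>gs\<in>level_lists d l. chain_class d l A gs)"
    by (intro finite_UN_I finite_level_lists finite_subset[OF chain_class_subset finite_spherical_section[OF A]])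
  ultimately have "card A \<le> card (\<Union>gs\<in>level_lists d l. chain_class d l A gs)"
    by (intro card_mono)
  also have "\<dots> \<le> (\<Sum>gs\<in>level_lists d l. card (chain_class d l A gs))"
    by (rule card_UN_le[OF finite_level_lists])
  finally show ?thesis .
qed

text \<open>Pigeonhole with the weights \<open>1 / last gs ^ (d + 2)\<close>: their sum over all lists of levels is
  bounded uniformly in \<open>l\<close>, and they lose less than the factor \<open>2 ^ last gs\<close> gained above.\<close>

lemma sum_power_card_sections:
  "\<exists>C>0. \<forall>n l. n < 2 ^ l \<longrightarrow>
    (\<Sum>A\<in>spherical_sections d n. real (card A) ^ (d + 2)) \<le> C * (2 ^ l) ^ (d * (d + 1))"
proof -
  define m where "m = d + 2"
  \<comment> \<open>The bound on the number of lists with last entry \<open>a\<close>, times the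
    weight; \<open>f2\<close> has instead the inverse weight to the power \<open>m\<close>, divided
    by \<open>2 ^ a\<close>. \<open>\<Theta>\<close> and \<open>C2\<close> bound the two sums for
    all \<open>l\<close>.\<close>
  define f1 where "f1 a = real d * real a ^ d * (1 / real a ^ (d + 2))" for a
  define f2 where "f2 a = real d * real a ^ d * ((real a ^ m) ^ m / 2 ^ a)" for a
  have f1_nonneg: "f1 a \<ge> 0" and f2_nonneg: "f2 a \<ge> 0" for a
    unfolding f1_def f2_def by simp_all
  have "f1 \<in> O(\<lambda>a. 1 / real a ^ 2)" unfolding f1_def by (rule bigoI[of _ "real d"]) (auto simp: power_add power2_eq_square divide_simps)
  then obtain \<Theta> where \<Theta>: "\<Theta> > 0" "\<And>l. (\<Sum>a\<in>{1..l}. f1 a) \<le> \<Theta>"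
    using sum_le_of_bigo_inverse_square[of f1] f1_nonneg by blast
  have "(\<lambda>a. real d * real a ^ d * (real a ^ (m * m) / 2 ^ a)) \<in> O(\<lambda>a. 1 / real a ^ 2)"
    by real_asymp
  then have "f2 \<in> O(\<lambda>a. 1 / real a ^ 2)" unfolding f2_def by (simp add: power_mult)
  then obtain C2 where C2: "C2 > 0" "\<And>l. (\<Sum>a\<in>{1..l}. f2 a) \<le> C2"
    using sum_le_of_bigo_inverse_square[of f2] f2_nonneg by blast
  define K where "K = real (cell_const d ^ (d * (d + 1)) * 2 ^ (d * d))"
  have "cell_const d > 0" by (simp add: cell_const_def)
  then have K0: "K > 0" unfolding K_def of_nat_0_less_iff by simp
  have main: "(\<Sum>A\<in>spherical_sections d n. real (card A) ^ m) \<le> \<Theta> ^ m * K * C2 * (2 ^ l) ^ (d * (d + 1))"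
    if n: "n < 2 ^ l" for n l
  proof -
    let ?\<A> = "spherical_sections d n"
    let ?T = "level_lists d l"
    define e where "e A gs = real (card (chain_class d l A gs))" for A gs
    \<comment> \<open>If every class were smaller than its weighted share of \<open>card A\<close>,
      the shares would add up to less than \<open>card A\<close>. So one class has its share, and
      its term alone suffices.\<close>
    have one: "real (card A) ^ m \<le> (\<Sum>gs\<in>?T. (\<Theta> * real (last gs) ^ m * e A gs) ^ m)" if A: "A \<in> ?\<A>" for A
    proof -
      have A0: "real (card A) > 0" using A by (auto simp: spherical_sections_def)
      have le: "real (card A) \<le> (\<Sum>gs\<in>?T. e A gs)"
        using card_section_le_sum[OF A n] unfolding e_def
        by (metis of_nat_le_iff of_nat_sum)
      have T: "?T \<noteq> {}" using le A0 by auto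
      have "\<exists>gs\<in>?T. real (card A) \<le> \<Theta> * real (last gs) ^ m * e A gs"
      proof (rule ccontr)
        assume "\<not> ?thesis"
        then have lt: "\<Theta> * real (last gs) ^ m * e A gs < real (card A)" if "gs \<in> ?T" for gs
          using that by (auto simp: not_le)
        have "\<Theta> * e A gs < real (card A) * (1 / real (last gs) ^ m)" if gs: "gs \<in> ?T" for gs
        proof -
          have "last gs \<in> {1..l}" using gs last_in_set[of gs] unfolding level_lists_def by blast
          then have "real (last gs) ^ m > 0" by simp
          then show ?thesis using lt[OF gs] by (simp add: field_simps)
        qed
        then have "(\<Sum>gs\<in>?T. \<Theta> * e A gs) < (\<Sum>gs\<in>?T. real (card A) * (1 / real (last gs) ^ m))"
          using T by (intro sum_strict_mono finite_level_lists)
        also have "\<dots> = real (card A) * (\<Sum>gs\<in>?T. 1 / real (last gs) ^ m)"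
          by (simp only: sum_distrib_left)
        also have "\<dots> \<le> real (card A) * (\<Sum>a\<in>{1..l}. f1 a)"
          unfolding f1_def m_def
          using sum_level_lists_le[of "\<lambda>a. 1 / real a ^ (d + 2)" d l] by (intro mult_left_mono) simp_all
        also have "\<dots> \<le> real (card A) * \<Theta>" using \<Theta>(2) by (intro mult_left_mono) simp_all
        also have "\<dots> \<le> (\<Sum>gs\<in>?T. \<Theta> * e A gs)"
          using le \<Theta>(1) by (simp add: sum_distrib_left[symmetric] mult.commute)
        finally show False by simp
      qed
      then obtain gs where gs: "gs \<in> ?T" "real (card A) \<le> \<Theta> * real (last gs) ^ m * e A gs" by blast
      have "real (card A) ^ m \<le> (\<Theta> * real (last gs) ^ m * e A gs) ^ m"
        using gs(2) by (rule power_mono) simp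
      also have "\<dots> \<le> (\<Sum>gs\<in>?T. (\<Theta> * real (last gs) ^ m * e A gs) ^ m)"
        using gs(1) \<Theta>(1) by (intro member_le_sum finite_level_lists) (auto simp: e_def)
      finally show ?thesis .
    qed
    have two: "(\<Sum>A\<in>?\<A>. e A gs ^ m) \<le> K * (2 ^ l) ^ (d * (d + 1)) / 2 ^ last gs" if gs: "gs \<in> ?T" for gs
    proof -
      have "real ((\<Sum>A\<in>?\<A>. card (chain_class d l A gs) ^ (d + 2)) * 2 ^ last gs)
          \<le> real (cell_const d ^ (d * (d + 1)) * 2 ^ (d * d) * (2 ^ l) ^ (d * (d + 1)))"
        using sum_power_card_chain_class[OF gs n] by (simp only: of_nat_le_iff)
      then have "(\<Sum>A\<in>?\<A>. e A gs ^ m) * 2 ^ last gs \<le> K * (2 ^ l) ^ (d * (d + 1))"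
        by (simp add: e_def m_def K_def)
      then show ?thesis by (simp add: pos_le_divide_eq)
    qed
    have "(\<Sum>A\<in>?\<A>. real (card A) ^ m) \<le> (\<Sum>A\<in>?\<A>. \<Sum>gs\<in>?T. (\<Theta> * real (last gs) ^ m * e A gs) ^ m)"
      using one by (rule sum_mono)
    also have "\<dots> = (\<Sum>gs\<in>?T. \<Theta> ^ m * (real (last gs) ^ m) ^ m * (\<Sum>A\<in>?\<A>. e A gs ^ m))"
      by (subst sum.swap) (simp add: power_mult_distrib sum_distrib_left)
    also have "\<dots> \<le> (\<Sum>gs\<in>?T. \<Theta> ^ m * (real (last gs) ^ m) ^ m * (K * (2 ^ l) ^ (d * (d + 1)) / 2 ^ last gs))"
      using two \<Theta>(1) by (intro sum_mono mult_left_mono) auto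
    also have "\<dots> = \<Theta> ^ m * K * (2 ^ l) ^ (d * (d + 1)) * (\<Sum>gs\<in>?T. (real (last gs) ^ m) ^ m / 2 ^ last gs)"
      unfolding sum_distrib_left by (rule sum.cong) simp_all
    also have "\<dots> \<le> \<Theta> ^ m * K * (2 ^ l) ^ (d * (d + 1)) * (\<Sum>a\<in>{1..l}. f2 a)"
      unfolding f2_def
      using sum_level_lists_le[of "\<lambda>a. (real a ^ m) ^ m / 2 ^ a" d l] \<Theta>(1) K0
      by (intro mult_left_mono) simp_all
    also have "\<dots> \<le> \<Theta> ^ m * K * (2 ^ l) ^ (d * (d + 1)) * C2"
      using C2(2) \<Theta>(1) K0 by (intro mult_left_mono) simp_all
    finally show ?thesis by (simp add: mult.assoc mult.commute mult.left_commute)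
  qed
  show ?thesis
    using main \<Theta>(1) K0 C2(1) unfolding m_def
    by (intro exI[of _ "\<Theta> ^ (d + 2) * K * C2"]) simp
qed

text \<open>A tuple is a list over the section cut out by its own sphere. Lists over several
  sections are counted several times, which is harmless for an upper bound.\<close>

lemma cospherical_count_le_sum:
  "real (cospherical_count n d) \<le> (\<Sum>A\<in>spherical_sections d n. real (card A) ^ (d + 2))"
proof -
  let ?T = "{ps. length ps = d + 2 \<and> distinct ps \<and> set ps \<subseteq> grid d n \<and>
               (\<exists>x0 \<in> Rspace d. \<exists>\<rho>>0. set ps \<subseteq> euclid_sphere d x0 \<rho>)}"
  let ?U = "\<lambda>A. {ps. set ps \<subseteq> A \<and> length ps = d + 2}"
  have sub: "?T \<subseteq> (\<Union>A\<in>spherical_sections d n. ?U A)"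
  proof
    fix ps assume "ps \<in> ?T"
    then obtain x0 \<rho> where ps: "length ps = d + 2" "distinct ps" "set ps \<subseteq> grid d n"
      "set ps \<subseteq> euclid_sphere d x0 \<rho>" by blast
    define A where "A = {x \<in> grid d n. (\<Sum>j<d. (x j - x0 j)\<^sup>2) = \<rho>\<^sup>2}"
    have sub: "set ps \<subseteq> A"
    proof
      fix x assume x: "x \<in> set ps"
      then have "L2_set (\<lambda>i. x i - x0 i) {..<d} = \<rho>" using ps(4) by (auto simp: euclid_sphere_def)
      then have "(\<Sum>j<d. (x j - x0 j)\<^sup>2) = \<rho>\<^sup>2"
        unfolding L2_set_def by (auto simp: sum_nonneg)
      then show "x \<in> A" using ps(3) x by (auto simp: A_def)
    qed
    have "card (set ps) \<le> card A"
      by (rule card_mono[OF _ sub]) (simp add: A_def finite_grid)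
    then have "2 \<le> card A" using ps(1) distinct_card[OF ps(2)] by simp
    then have "A \<in> spherical_sections d n" unfolding spherical_sections_def A_def by blast
    then show "ps \<in> (\<Union>A\<in>spherical_sections d n. ?U A)" using sub ps(1) by blast
  qed
  have fin: "finite (\<Union>A\<in>spherical_sections d n. ?U A)"
    by (intro finite_UN_I finite_spherical_sections finite_lists_length_eq finite_spherical_section)
  have "cospherical_count n d \<le> card (\<Union>A\<in>spherical_sections d n. ?U A)"
    unfolding cospherical_count_def by (rule card_mono[OF fin sub])
  also have "\<dots> \<le> (\<Sum>A\<in>spherical_sections d n. card (?U A))"
    by (rule card_UN_le[OF finite_spherical_sections])
  also have "\<dots> = (\<Sum>A\<in>spherical_sections d n. card A ^ (d + 2))"
    by (rule sum.cong) (simp_all add: card_lists_length_eq finite_spherical_section)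
  finally have "real (cospherical_count n d) \<le> real (\<Sum>A\<in>spherical_sections d n. card A ^ (d + 2))"
    by (simp only: of_nat_le_iff)
  then show ?thesis by (simp only: of_nat_sum of_nat_power)
qed

lemma cospherical_count_upper:
  "\<exists>C>0. \<forall>n\<ge>1. real (cospherical_count n d) \<le> C * real n ^ (d * (d + 1))"
proof -
  obtain C where C: "C > 0" "\<And>n l. n < 2 ^ l \<Longrightarrow>
      (\<Sum>A\<in>spherical_sections d n. real (card A) ^ (d + 2)) \<le> C * (2 ^ l) ^ (d * (d + 1))"
    using sum_power_card_sections[of d] by blast
  have "real (cospherical_count n d) \<le> C * 2 ^ (d * (d + 1)) * real n ^ (d * (d + 1))" if n: "n \<ge> 1" for n
  proof -
    obtain l where l: "n < 2 ^ l" "2 ^ l \<le> 2 * n" using exists_dyadic_scale[OF n] by blast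
    have "real (2 ^ l) \<le> real (2 * n)" using l(2) by (simp only: of_nat_le_iff)
    then have "(2 ^ l) ^ (d * (d + 1)) \<le> (2 * real n) ^ (d * (d + 1))"
      by (intro power_mono) simp_all
    then have "C * (2 ^ l) ^ (d * (d + 1)) \<le> C * (2 * real n) ^ (d * (d + 1))"
      using C(1) by simp
    then show ?thesis
      using cospherical_count_le_sum[of n d] C(2)[OF l(1)] by (simp only: power_mult_distrib)
  qed
  then show ?thesis using C(1) by (intro exI[of _ "C * 2 ^ (d * (d + 1))"]) simp
qed

section \<open>The lower bound\<close>

text \<open>A power mean inequality with a lossy constant, by truncation at half the average
  \<open>a\<close>: entries below \<open>a\<close> make up at most half of the sum, and the others
  satisfy \<open>M r ^ Suc q \<ge> a ^ q * M r\<close>.\<close>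

lemma power_mean_sum:
  fixes M :: "'a \<Rightarrow> real"
  assumes "finite R" "R \<noteq> {}" "\<And>r. r \<in> R \<Longrightarrow> 0 \<le> M r"
  shows "(\<Sum>r\<in>R. M r) ^ Suc q \<le> 2 * (2 * real (card R)) ^ q * (\<Sum>r\<in>R. M r ^ Suc q)"
proof -
  define a where "a = (\<Sum>r\<in>R. M r) / (2 * real (card R))"
  have cR: "real (card R) > 0" using assms by (simp add: card_gt_0_iff)
  have a0: "a \<ge> 0" unfolding a_def using assms by (simp add: sum_nonneg)
  have "a ^ q * (M r - a) \<le> M r ^ Suc q" if "r \<in> R" for r
  proof (cases "a \<le> M r")
    case True
    have "a ^ q * (M r - a) \<le> a ^ q * M r" using a0 by (simp add: mult_left_mono)
    also have "\<dots> \<le> M r ^ q * M r"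
      using True a0 by (intro mult_right_mono power_mono) auto
    finally show ?thesis by (simp add: mult.commute)
  next
    case False
    then have "a ^ q * (M r - a) \<le> 0" using a0 by (simp add: mult_nonneg_nonpos)
    also have "\<dots> \<le> M r ^ Suc q" using assms(3)[OF that] by simp
    finally show ?thesis .
  qed
  then have "(\<Sum>r\<in>R. a ^ q * (M r - a)) \<le> (\<Sum>r\<in>R. M r ^ Suc q)"
    by (rule sum_mono)
  moreover have "(\<Sum>r\<in>R. a ^ q * (M r - a)) = a ^ q * ((\<Sum>r\<in>R. M r) - real (card R) * a)"
    by (simp add: sum_distrib_left[symmetric] sum_subtractf)
  moreover have "real (card R) * a = (\<Sum>r\<in>R. M r) / 2"
    unfolding a_def using cR by simp
  ultimately have le: "a ^ q * ((\<Sum>r\<in>R. M r) / 2) \<le> (\<Sum>r\<in>R. M r ^ Suc q)"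
    by simp
  have "(\<Sum>r\<in>R. M r) ^ Suc q = 2 * (2 * real (card R)) ^ q * (a ^ q * ((\<Sum>r\<in>R. M r) / 2))"
    unfolding a_def using cR by (simp add: power_divide)
  also have "\<dots> \<le> 2 * (2 * real (card R)) ^ q * (\<Sum>r\<in>R. M r ^ Suc q)"
    using le by (intro mult_left_mono) auto
  finally show ?thesis .
qed

text \<open>Consider the row of the largest entry of \<open>w\<close> in absolute value: its
  diagonal term exceeds all the others together unless that entry is 0.\<close>

lemma diagonally_dominant_kernel:
  fixes w :: "nat \<Rightarrow> real" and b :: "nat \<Rightarrow> nat \<Rightarrow> real"
  assumes ker: "\<And>i. i < d \<Longrightarrow> (\<Sum>j<d. w j * b i j) = 0"
    and off: "\<And>i j. i < d \<Longrightarrow> j < d \<Longrightarrow> j \<noteq> i \<Longrightarrow> \<bar>b i j\<bar> \<le> h"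
    and diag: "\<And>i. i < d \<Longrightarrow> b i i > real d * h" and h: "h \<ge> 0" and i: "i < d"
  shows "w i = 0"
proof -
  have fin: "finite ((\<lambda>j. \<bar>w j\<bar>) ` {..<d})" "(\<lambda>j. \<bar>w j\<bar>) ` {..<d} \<noteq> {}" using i by auto
  obtain k where k: "k < d" "\<bar>w k\<bar> = Max ((\<lambda>j. \<bar>w j\<bar>) ` {..<d})" using Max_in[OF fin] by auto
  have wmax: "\<bar>w j\<bar> \<le> \<bar>w k\<bar>" if "j < d" for j unfolding k(2) using that by (intro Max_ge) auto
  have "(\<Sum>j<d. w j * b k j) = w k * b k k + (\<Sum>j\<in>{..<d} - {k}. w j * b k j)"
    using k(1) by (intro sum.remove) auto
  then have "\<bar>w k * b k k\<bar> = \<bar>\<Sum>j\<in>{..<d} - {k}. w j * b k j\<bar>" using ker[OF k(1)] by simp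
  also have "\<dots> \<le> (\<Sum>j\<in>{..<d} - {k}. \<bar>w k\<bar> * h)"
  proof (rule order.trans[OF sum_abs sum_mono])
    fix j assume "j \<in> {..<d} - {k}"
    then show "\<bar>w j * b k j\<bar> \<le> \<bar>w k\<bar> * h"
      unfolding abs_mult using wmax off[OF k(1)] by (intro mult_mono) auto
  qed
  also have "\<dots> = \<bar>w k\<bar> * (real (d - 1) * h)" using k(1) by simp
  also have "\<dots> \<le> \<bar>w k\<bar> * (real d * h)" using h by (intro mult_left_mono mult_right_mono) auto
  finally have le: "\<bar>w k\<bar> * \<bar>b k k\<bar> \<le> \<bar>w k\<bar> * (real d * h)" by (simp add: abs_mult)
  have "\<bar>w k\<bar> = 0"
  proof (rule ccontr)
    assume "\<bar>w k\<bar> \<noteq> 0"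
    then have "\<bar>b k k\<bar> \<le> real d * h" using le by simp
    then show False using diag[OF k(1)] by linarith
  qed
  then show ?thesis using wmax[OF i] by simp
qed

text \<open>The first \<open>d + 1\<close> sets give the affinely independent points.
  \<open>{0, 1}\<close> supplies the last point of the tuple; for \<open>d \<ge> 2\<close> it is a
  set of coordinates different from the others.\<close>

definition flips :: "nat \<Rightarrow> nat \<Rightarrow> nat set" where
  "flips d i = (if i < d then {i} else if i = d then {} else {0, 1})"

definition reflected :: "nat \<Rightarrow> (nat \<Rightarrow> nat) \<Rightarrow> (nat \<Rightarrow> nat) \<Rightarrow> nat \<Rightarrow> nat \<Rightarrow> real" where
  "reflected d c z i =
     (\<lambda>j\<in>{..<d}. if j \<in> flips d i then real (c j) - real (z j) else real (c j) + real (z j))"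

text \<open>The range lies just above the entries of a radius vector, so that
  \<open>c j - z j\<close> is at least 1, while \<open>c j + z j\<close> is at most
  \<open>(2 * d + 3) * h\<close>.\<close>

definition centres :: "nat \<Rightarrow> nat \<Rightarrow> (nat \<Rightarrow> nat) set" where
  "centres d h = ({..<d} \<rightarrow>\<^sub>E {(d + 1) * h + 1..(d + 2) * h})"

text \<open>Entries in a range of length \<open>h\<close>, but larger than \<open>d * h\<close>,
  make the differences of reflected points diagonally dominant.\<close>

definition radius_vectors :: "nat \<Rightarrow> nat \<Rightarrow> nat \<Rightarrow> (nat \<Rightarrow> nat) set" where
  "radius_vectors d h r = {z \<in> {..<d} \<rightarrow>\<^sub>E {d * h + 1..(d + 1) * h}. (\<Sum>j<d. (z j)\<^sup>2) = r}"

lemma finite_radius_vectors: "finite (radius_vectors d h r)"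
  unfolding radius_vectors_def by (rule finite_subset[of _ "{..<d} \<rightarrow>\<^sub>E {d * h + 1..(d + 1) * h}"])
    (auto intro!: finite_PiE)

lemma radius_vector_bounds:
  assumes "z \<in> radius_vectors d h r" "j < d"
  shows "d * h < z j" "z j \<le> (d + 1) * h"
proof -
  have "z j \<in> {d * h + 1..(d + 1) * h}"
    using assms PiE_mem[of z "{..<d}" "\<lambda>_. {d * h + 1..(d + 1) * h}" j]
    unfolding radius_vectors_def by blast
  then show "d * h < z j" "z j \<le> (d + 1) * h" unfolding atLeastAtMost_iff by linarith+
qed

lemma centre_bounds:
  assumes "c \<in> centres d h" "j < d"
  shows "(d + 1) * h < c j" "c j \<le> (d + 2) * h"
proof -
  have "c j \<in> {(d + 1) * h + 1..(d + 2) * h}"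
    using assms PiE_mem[of c "{..<d}" "\<lambda>_. {(d + 1) * h + 1..(d + 2) * h}" j]
    unfolding centres_def by blast
  then show "(d + 1) * h < c j" "c j \<le> (d + 2) * h" unfolding atLeastAtMost_iff by linarith+
qed

lemma reflected_in_grid:
  assumes c: "c \<in> centres d h" and z: "z \<in> radius_vectors d h r" and n: "(2 * d + 3) * h \<le> n"
  shows "reflected d c z i \<in> grid d n"
  unfolding grid_def
proof (rule PiE_I)
  fix j assume "j \<in> {..<d}"
  then have j: "j < d" by simp
  have lt: "z j < c j" using centre_bounds(1)[OF c j] radius_vector_bounds(2)[OF z j] by linarith
  have "c j + z j \<le> (d + 2) * h + (d + 1) * h"
    using centre_bounds(2)[OF c j] radius_vector_bounds(2)[OF z j] by linarith
  also have "\<dots> = (2 * d + 3) * h" by (simp add: algebra_simps)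
  finally have le: "c j + z j \<le> n" using n by linarith
  have "reflected d c z i j = real (if j \<in> flips d i then c j - z j else c j + z j)"
    using j lt by (auto simp: reflected_def)
  moreover have "(if j \<in> flips d i then c j - z j else c j + z j) \<in> {1..n}"
    using lt le by auto
  ultimately show "reflected d c z i j \<in> real ` {1..n}" by (rule image_eqI)
qed (simp add: reflected_def)

lemma sum_reflected:
  assumes z: "z \<in> radius_vectors d h r"
  shows "(\<Sum>j<d. (reflected d c z i j - real (c j))\<^sup>2) = real r"
proof -
  have "(\<Sum>j<d. (reflected d c z i j - real (c j))\<^sup>2) = (\<Sum>j<d. (real (z j))\<^sup>2)"
    by (rule sum.cong) (auto simp: reflected_def)
  also have "\<dots> = real (\<Sum>j<d. (z j)\<^sup>2)" by simp
  also have "(\<Sum>j<d. (z j)\<^sup>2) = r" using z by (simp only: radius_vectors_def mem_Collect_eq)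
  finally show ?thesis .
qed

text \<open>Where the sets of flips differ, one point lies below the centre and the other above it,
  even for different vectors \<open>z\<close> and \<open>z'\<close>.\<close>

lemma reflected_distinct:
  assumes d: "d \<ge> 2" and z: "z \<in> radius_vectors d h r" "z' \<in> radius_vectors d h r"
    and i: "i < d + 2" "i' < d + 2" and eq: "reflected d c z i = reflected d c z' i'"
  shows "i = i'"
proof (rule ccontr)
  assume "i \<noteq> i'"
  then have "flips d i \<noteq> flips d i'"
    using i d by (auto simp: flips_def doubleton_eq_iff split: if_splits)
  moreover have "flips d i \<subseteq> {..<d}" "flips d i' \<subseteq> {..<d}"
    using d by (auto simp: flips_def)
  ultimately obtain j where j: "j < d" "(j \<in> flips d i) \<noteq> (j \<in> flips d i')" by blast
  have "reflected d c z i j = reflected d c z' i' j" using eq by simp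
  moreover have "z j > 0" "z' j > 0"
    using radius_vector_bounds(1)[OF z(1) j(1)] radius_vector_bounds(1)[OF z(2) j(1)] by auto
  ultimately show False using j by (auto simp: reflected_def split: if_splits)
qed

text \<open>The differences of the first \<open>d\<close> reflected points with the unreflected one form a diagonally
  dominant matrix, so the points are affinely independent and determine their centre.\<close>

lemma reflected_determines:
  assumes h: "h \<ge> 1"
    and c: "c \<in> centres d h" "c' \<in> centres d h"
    and z: "\<And>i. i < d + 2 \<Longrightarrow> z i \<in> radius_vectors d h r"
    and z': "\<And>i. i < d + 2 \<Longrightarrow> z' i \<in> radius_vectors d h r'"
    and eq: "\<And>i. i < d + 2 \<Longrightarrow> reflected d c (z i) i = reflected d c' (z' i) i"
  shows "c = c'" and "i < d + 2 \<Longrightarrow> z i = z' i"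
proof -
  define w where "w j = real (c' j) - real (c j)" for j
  define x where "x i = reflected d c (z i) i" for i
  have x': "x i = reflected d c' (z' i) i" if "i < d + 2" for i using eq[OF that] by (simp add: x_def)
  have lin: "(\<Sum>j<d. w j * (2 * x i j - c j - c' j)) = real r - real r'" if i: "i < d + 2" for i
  proof -
    have "(\<Sum>j<d. w j * (2 * x i j - c j - c' j)) = (\<Sum>j<d. (x i j - c j)\<^sup>2 - (x i j - c' j)\<^sup>2)"
      unfolding w_def by (rule sum.cong) (auto simp: power2_eq_square algebra_simps)
    also have "\<dots> = real r - real r'"
      using sum_reflected[OF z[OF i], of c i] sum_reflected[OF z'[OF i], of c' i] x'[OF i]
      by (simp add: sum_subtractf x_def)
    finally show ?thesis .
  qed
  have w0: "w k = 0" if k: "k < d" for k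
  proof (rule diagonally_dominant_kernel[where b = "\<lambda>i j. x d j - x i j" and h = "real h", OF _ _ _ _ k])
    fix i assume i: "i < d"
    \<comment> \<open>Subtracting equation \<open>i\<close> from equation \<open>d\<close> removes
      \<open>r - r'\<close>, so that different radii are covered as well.\<close>
    have "2 * (\<Sum>j<d. w j * (x d j - x i j))
        = (\<Sum>j<d. w j * (2 * x d j - c j - c' j)) - (\<Sum>j<d. w j * (2 * x i j - c j - c' j))"
      unfolding sum_subtractf[symmetric] sum_distrib_left
      by (rule sum.cong) (auto simp: algebra_simps)
    then show "(\<Sum>j<d. w j * (x d j - x i j)) = 0" using lin[of d] lin[of i] i by simp
    have zd: "z d \<in> radius_vectors d h r" and zi: "z i \<in> radius_vectors d h r" using z i by auto
    \<comment> \<open>On the diagonal the two entries add up, whereas off it they cancel up to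
      \<open>h\<close>.\<close>
    have "x d i - x i i = real (z d i) + real (z i i)"
      using i by (simp add: x_def reflected_def flips_def)
    moreover have "real (z d i) > real d * real h"
      using radius_vector_bounds(1)[OF zd i] by (metis of_nat_less_iff of_nat_mult)
    ultimately show "x d i - x i i > real d * real h" by simp
    fix j assume j: "j < d" "j \<noteq> i"
    have "x d j - x i j = real (z d j) - real (z i j)"
      using i j by (simp add: x_def reflected_def flips_def)
    moreover have "z d j \<le> z i j + h" "z i j \<le> z d j + h"
      using radius_vector_bounds[OF zd j(1)] radius_vector_bounds[OF zi j(1)] by simp_all
    ultimately show "\<bar>x d j - x i j\<bar> \<le> real h" by linarith
  qed simp
  show cc: "c = c'"
  proof (rule PiE_ext[OF c[unfolded centres_def]])
    fix j assume "j \<in> {..<d}"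
    then show "c j = c' j" using w0[of j] by (simp add: w_def)
  qed
  show "z i = z' i" if i: "i < d + 2"
  proof (rule PiE_ext)
    show "z i \<in> {..<d} \<rightarrow>\<^sub>E {d * h + 1..(d + 1) * h}" "z' i \<in> {..<d} \<rightarrow>\<^sub>E {d * h + 1..(d + 1) * h}"
      using z[OF i] z'[OF i] by (simp_all add: radius_vectors_def)
    fix j assume "j \<in> {..<d}"
    then show "z i j = z' i j" using fun_cong[OF eq[OF i], of j] cc
      by (simp add: reflected_def split: if_splits)
  qed
qed

text \<open>Every point of a tuple uses its own vector \<open>z i\<close> with the common value
  \<open>r\<close> and its own reflection, so the choices are independent and give the power
  \<open>d + 2\<close>.\<close>

lemma cospherical_count_ge:
  assumes d: "d \<ge> 2" and h: "h \<ge> 1" and n: "(2 * d + 3) * h \<le> n" and R: "finite R"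
  shows "h ^ d * (\<Sum>r\<in>R. card (radius_vectors d h r) ^ (d + 2)) \<le> cospherical_count n d"
proof -
  let ?T = "{ps. length ps = d + 2 \<and> distinct ps \<and> set ps \<subseteq> grid d n \<and>
               (\<exists>x0 \<in> Rspace d. \<exists>\<rho>>0. set ps \<subseteq> euclid_sphere d x0 \<rho>)}"
  let ?Z = "\<lambda>r. {..<d + 2} \<rightarrow>\<^sub>E radius_vectors d h r"
  let ?S = "centres d h \<times> (\<Union>r\<in>R. ?Z r)"
  let ?F = "\<lambda>(c, z). map (\<lambda>i. reflected d c (z i) i) [0..<d + 2]"
  have finZ: "finite (?Z r)" for r by (intro finite_PiE) (auto simp: finite_radius_vectors)
  have disj: "?Z r \<inter> ?Z s = {}" if "r \<noteq> s" for r s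
  proof -
    have False if "z \<in> ?Z r" "z \<in> ?Z s" for z
    proof -
      have "z 0 \<in> radius_vectors d h r" "z 0 \<in> radius_vectors d h s" using that by auto
      then show False using \<open>r \<noteq> s\<close> by (simp add: radius_vectors_def)
    qed
    then show ?thesis by blast
  qed
  have "card (\<Union>r\<in>R. ?Z r) = (\<Sum>r\<in>R. card (?Z r))"
    using R finZ disj by (intro card_UN_disjoint) auto
  then have cS: "card ?S = h ^ d * (\<Sum>r\<in>R. card (radius_vectors d h r) ^ (d + 2))"
    by (simp add: card_cartesian_product centres_def card_PiE)
  have inj: "inj_on ?F ?S"
  proof (rule inj_onI)
    fix u v assume u: "u \<in> ?S" and v: "v \<in> ?S" and eq: "?F u = ?F v"
    obtain c z where uc: "u = (c, z)" by (cases u)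
    obtain c' z' where vc: "v = (c', z')" by (cases v)
    obtain r where zr: "z \<in> ?Z r" using u unfolding uc by auto
    obtain r' where zr': "z' \<in> ?Z r'" using v unfolding vc by auto
    have e: "reflected d c (z i) i = reflected d c' (z' i) i" if "i < d + 2" for i
      using eq that unfolding uc vc by (simp add: list_eq_iff_nth_eq del: upt_Suc)
    have c: "c \<in> centres d h" "c' \<in> centres d h" using u v unfolding uc vc by auto
    have zi: "z i \<in> radius_vectors d h r" "z' i \<in> radius_vectors d h r'" if "i < d + 2" for i
      using zr zr' that by auto
    have "c = c'" using reflected_determines(1)[OF h c zi e] .
    moreover have "z = z'"
    proof (rule extensionalityI)
      show "z \<in> extensional {..<d + 2}" "z' \<in> extensional {..<d + 2}"
        using zr zr' by (simp_all add: PiE_iff)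
      show "z i = z' i" if "i \<in> {..<d + 2}" for i
        using reflected_determines(2)[OF h c zi e] that by simp
    qed
    ultimately show "u = v" using uc vc by simp
  qed
  have into: "?F ` ?S \<subseteq> ?T"
  proof (rule image_subsetI)
    fix u assume u: "u \<in> ?S"
    obtain c z where uc: "u = (c, z)" by (cases u)
    obtain r where zr: "z \<in> ?Z r" using u unfolding uc by auto
    have c: "c \<in> centres d h" using u unfolding uc by auto
    have zi: "z i \<in> radius_vectors d h r" if "i < d + 2" for i using zr that by auto
    define x0 where "x0 = (\<lambda>j\<in>{..<d}. real (c j))"
    have "z 0 0 > 0" using radius_vector_bounds(1)[OF zi, of 0 0] d by auto
    then have "(\<Sum>j<d. (z 0 j)\<^sup>2) > 0" using d by (intro sum_pos2[of _ 0]) auto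
    then have "r > 0" using zi[of 0] by (auto simp: radius_vectors_def)
    have sph: "reflected d c (z i) i \<in> euclid_sphere d x0 (sqrt (real r))" if i: "i < d + 2" for i
    proof -
      have "L2_set (\<lambda>j. reflected d c (z i) i j - x0 j) {..<d}
          = sqrt (\<Sum>j<d. (reflected d c (z i) i j - real (c j))\<^sup>2)"
        unfolding L2_set_def by (intro arg_cong[of _ _ sqrt] sum.cong) (auto simp: x0_def)
      then show ?thesis
        using sum_reflected[OF zi[OF i], of c i]
        by (simp add: euclid_sphere_def Rspace_def reflected_def)
    qed
    have "inj_on (\<lambda>i. reflected d c (z i) i) {..<d + 2}"
      by (rule inj_onI) (use reflected_distinct[OF d zi zi] in \<open>simp only: lessThan_iff\<close>)
    then have "distinct (?F u)"
      unfolding uc by (simp add: distinct_map lessThan_atLeast0 del: upt_Suc)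
    moreover have "set (?F u) \<subseteq> grid d n"
      unfolding uc using reflected_in_grid[OF c zi n] by (auto simp del: upt_Suc)
    moreover have "\<exists>x0\<in>Rspace d. \<exists>\<rho>>0. set (?F u) \<subseteq> euclid_sphere d x0 \<rho>"
    proof (intro bexI[of _ x0] exI[of _ "sqrt (real r)"] conjI)
      show "set (?F u) \<subseteq> euclid_sphere d x0 (sqrt (real r))"
        unfolding uc using sph by (auto simp del: upt_Suc)
      show "x0 \<in> Rspace d" by (simp add: x0_def Rspace_def)
    qed (use \<open>r > 0\<close> in simp)
    moreover have "length (?F u) = d + 2" unfolding uc by simp
    ultimately show "?F u \<in> ?T" by blast
  qed
  have fin: "finite ?T"
    by (rule finite_subset[OF _ finite_lists_length_eq[OF finite_grid[of d n], of "d + 2"]]) auto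
  have "card ?S \<le> card ?T" by (rule card_inj_on_le[OF inj into fin])
  then show ?thesis using cS by (simp add: cospherical_count_def)
qed

lemma cospherical_count_lower:
  assumes d: "d \<ge> 2"
  shows "\<exists>C>0. \<forall>n\<ge>2 * d + 3. real n ^ (d^2 + d - 2) \<le> C * real (cospherical_count n d)"
proof -
  \<comment> \<open>\<open>B\<close> is the constant of the power mean inequality for
    \<open>d * (d + 1)^2 * h^2\<close> values of \<open>r\<close>, without the power of
    \<open>h\<close>; \<open>D\<close> comes from
    \<open>n \<le> 2 * (2 * d + 3) * h\<close>.\<close>
  define B where "B = 2 * (2 * (real d * (real d + 1)\<^sup>2)) ^ (d + 1)"
  define D where "D = (2 * (2 * real d + 3)) ^ (d^2 + d - 2)"
  have B0: "B > 0" using d by (simp add: B_def)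
  have D0: "D > 0" by (simp add: D_def add_pos_nonneg)
  have "real n ^ (d^2 + d - 2) \<le> D * B * real (cospherical_count n d)" if n: "n \<ge> 2 * d + 3" for n
  proof -
    define h where "h = n div (2 * d + 3)"
    have h1: "h \<ge> 1" using n by (simp add: h_def div_greater_zero_iff Suc_le_eq)
    have hn: "(2 * d + 3) * h \<le> n" by (simp add: h_def)
    have "n < (2 * d + 3) * (h + 1)"
      using dividend_less_times_div[of "2 * d + 3" n] by (simp add: h_def)
    also have "\<dots> \<le> (2 * d + 3) * (2 * h)" using h1 by (intro mult_left_mono) auto
    also have "\<dots> = 2 * (2 * d + 3) * h" by (simp only: mult_ac)
    finally have nh: "n \<le> 2 * (2 * d + 3) * h" by (rule less_imp_le)
    define P where "P = {..<d} \<rightarrow>\<^sub>E {d * h + 1..(d + 1) * h}"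
    define R where "R = {1..d * ((d + 1) * h)\<^sup>2}"
    define M where "M r = card (radius_vectors d h r)" for r
    have cP: "card P = h ^ d" by (simp add: P_def card_PiE)
    have finP: "finite P" unfolding P_def by (intro finite_PiE) auto
    have sumR: "(\<Sum>j<d. (z j)\<^sup>2) \<in> R" if z: "z \<in> P" for z
    proof -
      have zj: "0 < z j \<and> z j \<le> (d + 1) * h" if "j < d" for j
      proof -
        have "z j \<in> {d * h + 1..(d + 1) * h}" using PiE_mem[OF z[unfolded P_def], of j] that by simp
        then show ?thesis unfolding atLeastAtMost_iff by linarith
      qed
      have "(\<Sum>j<d. (z j)\<^sup>2) \<le> (\<Sum>j<d. ((d + 1) * h)\<^sup>2)"
        using zj by (intro sum_mono power_mono) auto
      moreover have "(\<Sum>j<d. (z j)\<^sup>2) > 0" using zj[of 0] d by (intro sum_pos2[of _ 0]) auto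
      ultimately show ?thesis by (simp add: R_def)
    qed
    have "(\<Sum>r\<in>R. M r) = card P"
    proof -
      have "card P = (\<Sum>z\<in>P. 1)" by simp
      also have "\<dots> = (\<Sum>r\<in>R. \<Sum>z\<in>{z\<in>P. (\<Sum>j<d. (z j)\<^sup>2) = r}. 1)"
        using sumR by (intro sum.group[symmetric] finP) (auto simp: R_def)
      finally show ?thesis by (simp add: M_def radius_vectors_def P_def)
    qed
    then have sM: "(\<Sum>r\<in>R. real (M r)) = real h ^ d" unfolding cP by (simp flip: of_nat_sum)
    have Rne: "R \<noteq> {}" using d h1 by (simp add: R_def)
    have "real (card R) = real d * ((real d + 1) * real h)\<^sup>2"
      by (simp add: R_def algebra_simps)
    then have cR: "real (card R) = real d * (real d + 1)\<^sup>2 * real h ^ 2"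
      by (simp only: power_mult_distrib mult.assoc)
    have "(real h ^ d) ^ Suc (d + 1) \<le> 2 * (2 * real (card R)) ^ (d + 1) * (\<Sum>r\<in>R. real (M r) ^ Suc (d + 1))"
      using power_mean_sum[of R "\<lambda>r. real (M r)" "d + 1"] Rne unfolding sM by (simp add: R_def)
    also have "2 * (2 * real (card R)) ^ (d + 1) = B * real h ^ (2 * (d + 1))"
      unfolding cR B_def by (simp only: power_mult_distrib power_mult mult.assoc)
    finally have "(real h ^ d) ^ Suc (d + 1) * real h ^ d
        \<le> B * real h ^ (2 * (d + 1)) * (\<Sum>r\<in>R. real (M r) ^ Suc (d + 1)) * real h ^ d"
      by (rule mult_right_mono) simp
    also have "\<dots> = B * real h ^ (2 * (d + 1)) * real (h ^ d * (\<Sum>r\<in>R. M r ^ (d + 2)))"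
      by (simp add: mult.assoc mult.commute)
    also have "\<dots> \<le> B * real h ^ (2 * (d + 1)) * real (cospherical_count n d)"
    proof (rule mult_left_mono)
      show "real (h ^ d * (\<Sum>r\<in>R. M r ^ (d + 2))) \<le> real (cospherical_count n d)"
        unfolding of_nat_le_iff M_def by (rule cospherical_count_ge[OF d h1 hn]) (simp add: R_def)
    qed (use B0 in simp)
    finally have "(real h ^ d) ^ Suc (d + 1) * real h ^ d
        \<le> real h ^ (2 * (d + 1)) * (B * real (cospherical_count n d))"
      by (simp only: ac_simps)
    \<comment> \<open>Dividing by \<open>h ^ (2 * (d + 1))\<close>, the price of O(h^2) values of
      \<open>r\<close> in the power mean inequality, leaves the claimed exponent.\<close>
    moreover have "(real h ^ d) ^ Suc (d + 1) * real h ^ d = real h ^ (2 * (d + 1)) * real h ^ (d^2 + d - 2)"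
    proof -
      have "d * Suc (d + 1) + d = 2 * (d + 1) + (d^2 + d - 2)"
        using d by (simp add: power2_eq_square algebra_simps)
      then show ?thesis by (simp only: power_mult[symmetric] power_add[symmetric])
    qed
    ultimately have "real h ^ (2 * (d + 1)) * real h ^ (d^2 + d - 2)
        \<le> real h ^ (2 * (d + 1)) * (B * real (cospherical_count n d))"
      by simp
    then have "real h ^ (d^2 + d - 2) \<le> B * real (cospherical_count n d)"
      by (rule mult_left_le_imp_le) (use h1 in simp)
    then have "D * real h ^ (d^2 + d - 2) \<le> D * (B * real (cospherical_count n d))"
      using D0 by simp
    moreover have "real n ^ (d^2 + d - 2) \<le> D * real h ^ (d^2 + d - 2)"
    proof -
      have "real n \<le> real (2 * (2 * d + 3) * h)" using nh by (simp only: of_nat_le_iff)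
      then have "real n \<le> 2 * (2 * real d + 3) * real h" by simp
      then have "real n ^ (d^2 + d - 2) \<le> (2 * (2 * real d + 3) * real h) ^ (d^2 + d - 2)"
        by (intro power_mono) auto
      then show ?thesis by (simp only: D_def power_mult_distrib)
    qed
    ultimately show ?thesis by (simp add: mult.assoc)
  qed
  then show ?thesis using B0 D0 by (intro exI[of _ "D * B"]) simp
qed

theorem theorem1p5:
  "\<exists>c::real. \<forall>d::nat. d \<ge> 3 \<longrightarrow>
     lesssim (\<lambda>n. real n ^ (d^2 + d - 2)) (\<lambda>n. real (cospherical_count n d)) \<and>
     lesssim (\<lambda>n. real (cospherical_count n d))
       (\<lambda>n. real n powr (real d ^ 2 + 2 * real d - 4 + c / ln (ln (real n)))
            + real n ^ (d^2 + d) * ln (real n))"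
proof (intro exI[of _ 0] allI impI conjI)
  fix d :: nat
  assume d: "d \<ge> 3"
  then obtain C where C: "C > 0"
    "\<And>n. n \<ge> 2 * d + 3 \<Longrightarrow> real n ^ (d^2 + d - 2) \<le> C * real (cospherical_count n d)"
    using cospherical_count_lower[of d] by auto
  show "lesssim (\<lambda>n. real n ^ (d^2 + d - 2)) (\<lambda>n. real (cospherical_count n d))"
    unfolding lesssim_def
    using C by (intro exI[of _ C] conjI eventually_sequentiallyI[of "2 * d + 3"]) auto
  obtain K where K: "K > 0"
    "\<And>n. n \<ge> 1 \<Longrightarrow> real (cospherical_count n d) \<le> K * real n ^ (d * (d + 1))"
    using cospherical_count_upper[of d] by blast
  show "lesssim (\<lambda>n. real (cospherical_count n d))
      (\<lambda>n. real n powr (real d ^ 2 + 2 * real d - 4 + 0 / ln (ln (real n)))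
            + real n ^ (d^2 + d) * ln (real n))"
    unfolding lesssim_def
  proof (intro exI[of _ K] conjI K(1) eventually_sequentiallyI[of 3])
    fix n :: nat
    assume n: "3 \<le> n"
    \<comment> \<open>From 3 on the logarithm is at least 1, so the bound without it implies the one
      with it; the other summand is nonnegative.\<close>
    have "exp 1 \<le> real n" using exp_le n by linarith
    then have ln1: "1 \<le> ln (real n)" using n by (simp add: ln_ge_iff)
    have "real (cospherical_count n d) \<le> K * real n ^ (d^2 + d)"
      using K(2)[of n] n by (simp add: power2_eq_square add.commute)
    also have "\<dots> \<le> K * (real n ^ (d^2 + d) * ln (real n))"
      using K(1) ln1 by (simp add: mult_le_cancel_left1)
    also have "\<dots> \<le> K * (real n powr (real d ^ 2 + 2 * real d - 4 + 0 / ln (ln (real n)))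
        + real n ^ (d^2 + d) * ln (real n))"
      using K(1) by (intro mult_left_mono) simp_all
    finally show "real (cospherical_count n d) \<le>
        K * (real n powr (real d ^ 2 + 2 * real d - 4 + 0 / ln (ln (real n)))
        + real n ^ (d^2 + d) * ln (real n))" .
  qed
qed

end
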